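(* Let $R$ be an HNP ring which has infinitely many isomorphism classes of simple right modules. Then $Q(R)$ cannot be generated as a ring by $R$ together with finitely many elements of $Q(R)$. In particular, $Q(R)$ is not affine as a $Z(R)$-algebra.
   Context: All rings are associative with unit. An HNP ring is a hereditary noetherian prime ring (hereditary and noetherian on both the right and the left). $Q(R)$ denotes the Goldie quotient ring (simple artinian ring of fractions) of $R$, and $Z(R)$ is the center of $R$. An algebra is affine over a commutative ring $C$ if it is finitely generated as a $C$-algebra. *)

theory Defs
  imports "HOL-Algebra.Algebra"
begin

section \<open>Right modules over a noncommutative ring\<close>

text \<open>
  The library locale \<open>module\<close> requires a commutative ring of scalars. We keep its record type and
  read \<open>r \<odot>\<^bsub>M\<^esub> x\<close> as the right action \<open>x \<cdot> r\<close>; hence the reversed order in \<open>ract_assoc\<close>.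
  The fields \<open>mult\<close> and \<open>one\<close> of a module record carry no meaning.
\<close>

locale right_module = R?: ring R + M?: abelian_group M
  for R :: "('a, 'r) ring_scheme" (structure) and M :: "('a, 'm, 'x) module_scheme" (structure) +
  assumes ract_closed:
      "\<lbrakk>a \<in> carrier R; x \<in> carrier M\<rbrakk> \<Longrightarrow> a \<odot>\<^bsub>M\<^esub> x \<in> carrier M"
    and ract_distrib_scalar:
      "\<lbrakk>a \<in> carrier R; b \<in> carrier R; x \<in> carrier M\<rbrakk>
        \<Longrightarrow> (a \<oplus>\<^bsub>R\<^esub> b) \<odot>\<^bsub>M\<^esub> x = a \<odot>\<^bsub>M\<^esub> x \<oplus>\<^bsub>M\<^esub> b \<odot>\<^bsub>M\<^esub> x"
    and ract_distrib_add:
      "\<lbrakk>a \<in> carrier R; x \<in> carrier M; y \<in> carrier M\<rbrakk>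
        \<Longrightarrow> a \<odot>\<^bsub>M\<^esub> (x \<oplus>\<^bsub>M\<^esub> y) = a \<odot>\<^bsub>M\<^esub> x \<oplus>\<^bsub>M\<^esub> a \<odot>\<^bsub>M\<^esub> y"
    and ract_assoc:
      "\<lbrakk>a \<in> carrier R; b \<in> carrier R; x \<in> carrier M\<rbrakk>
        \<Longrightarrow> (a \<otimes>\<^bsub>R\<^esub> b) \<odot>\<^bsub>M\<^esub> x = b \<odot>\<^bsub>M\<^esub> (a \<odot>\<^bsub>M\<^esub> x)"
    and ract_one:
      "x \<in> carrier M \<Longrightarrow> \<one>\<^bsub>R\<^esub> \<odot>\<^bsub>M\<^esub> x = x"

definition rmod_hom ::
  "('a, 'r) ring_scheme \<Rightarrow> ('a, 'm, 'x) module_scheme \<Rightarrow> ('a, 'n, 'y) module_scheme \<Rightarrow> ('m \<Rightarrow> 'n) set"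
  where "rmod_hom R M N = {f. f \<in> carrier M \<rightarrow> carrier N
    \<and> (\<forall>x \<in> carrier M. \<forall>y \<in> carrier M. f (x \<oplus>\<^bsub>M\<^esub> y) = f x \<oplus>\<^bsub>N\<^esub> f y)
    \<and> (\<forall>a \<in> carrier R. \<forall>x \<in> carrier M. f (a \<odot>\<^bsub>M\<^esub> x) = a \<odot>\<^bsub>N\<^esub> f x)}"

definition rmod_iso ::
  "('a, 'r) ring_scheme \<Rightarrow> ('a, 'm, 'x) module_scheme \<Rightarrow> ('a, 'n, 'y) module_scheme \<Rightarrow> bool"
  where "rmod_iso R M N \<longleftrightarrow> (\<exists>f \<in> rmod_hom R M N. bij_betw f (carrier M) (carrier N))"

definition simple_right_module ::
  "('a, 'r) ring_scheme \<Rightarrow> ('a, 'm, 'x) module_scheme \<Rightarrow> bool"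
  where "simple_right_module R M \<longleftrightarrow> right_module R M \<and> carrier M \<noteq> {\<zero>\<^bsub>M\<^esub>}
    \<and> (\<forall>H. submodule H R M \<longrightarrow> H = {\<zero>\<^bsub>M\<^esub>} \<or> H = carrier M)"

text \<open>
  Isomorphism classes of simple right \<open>R\<close>-modules. Every simple right module, whatever its carrier
  type, is isomorphic to \<open>R/I\<close> for a maximal right ideal \<open>I\<close>, and the elements of \<open>R/I\<close> are cosets,
  of type \<open>'a set\<close>; so every isomorphism class is represented at this carrier type.
\<close>

definition simple_right_module_classes ::
  "('a, 'r) ring_scheme \<Rightarrow> ('a, 'a set) module set set"
  where "simple_right_module_classes R =
    {M. simple_right_module R M} //
    {(M, N). simple_right_module R M \<and> simple_right_module R N \<and> rmod_iso R M N}"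

text \<open>
  The lifting property of projective modules. HOL cannot quantify over the carrier types of \<open>M\<close> and
  \<open>N\<close>; fixing them as below loses nothing, since taking for \<open>M\<close> the free module on the set
  \<open>carrier P\<close> (finitely supported functions, of type \<open>'m \<Rightarrow> 'a\<close>), \<open>N = P\<close> and \<open>g = id\<close> makes \<open>P\<close> a
  direct summand of a free module, hence liftable against every epimorphism.
\<close>

definition right_projective ::
  "('a, 'r) ring_scheme \<Rightarrow> ('a, 'm, 'x) module_scheme \<Rightarrow> bool"
  where "right_projective R P \<longleftrightarrow> right_module R P \<and>
    (\<forall>(M :: ('a, 'm \<Rightarrow> 'a) module) (N :: ('a, 'm) module) f g.
       right_module R M \<and> right_module R N \<and>
       f \<in> rmod_hom R M N \<and> f ` carrier M = carrier N \<and> g \<in> rmod_hom R P N \<longrightarrow>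
       (\<exists>h \<in> rmod_hom R P M. \<forall>x \<in> carrier P. f (h x) = g x))"

section \<open>HNP rings\<close>

definition right_ideal :: "'a set \<Rightarrow> ('a, 'r) ring_scheme \<Rightarrow> bool"
  where "right_ideal I R \<longleftrightarrow> additive_subgroup I R \<and>
    (\<forall>a \<in> I. \<forall>x \<in> carrier R. a \<otimes>\<^bsub>R\<^esub> x \<in> I)"

definition right_regular_module :: "('a, 'r) ring_scheme \<Rightarrow> ('a, 'a) module"
  where "right_regular_module R = \<lparr>carrier = carrier R, monoid.mult = (\<otimes>\<^bsub>R\<^esub>), one = \<one>\<^bsub>R\<^esub>,
    ring.zero = \<zero>\<^bsub>R\<^esub>, add = (\<oplus>\<^bsub>R\<^esub>), smult = (\<lambda>r x. x \<otimes>\<^bsub>R\<^esub> r)\<rparr>"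

definition right_noetherian :: "('a, 'r) ring_scheme \<Rightarrow> bool"
  where "right_noetherian R \<longleftrightarrow> (\<forall>I :: nat \<Rightarrow> 'a set.
    (\<forall>n. right_ideal (I n) R \<and> I n \<subseteq> I (Suc n)) \<longrightarrow> (\<exists>k. \<forall>n \<ge> k. I n = I k))"

definition right_hereditary :: "('a, 'r) ring_scheme \<Rightarrow> bool"
  where "right_hereditary R \<longleftrightarrow> (\<forall>I. right_ideal I R \<longrightarrow>
    right_projective R ((right_regular_module R)\<lparr>carrier := I\<rparr>))"

text \<open>Left-hand conditions on \<open>R\<close> are the right-hand conditions on the opposite ring.\<close>

definition opposite_ring :: "('a, 'r) ring_scheme \<Rightarrow> ('a, 'r) ring_scheme"
  where "opposite_ring R = R\<lparr>monoid.mult := (\<lambda>x y. y \<otimes>\<^bsub>R\<^esub> x)\<rparr>"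

text \<open>The library locale \<open>primeideal\<close> is restricted to commutative rings.\<close>

definition prime_ring :: "('a, 'r) ring_scheme \<Rightarrow> bool"
  where "prime_ring R \<longleftrightarrow> \<one>\<^bsub>R\<^esub> \<noteq> \<zero>\<^bsub>R\<^esub> \<and> (\<forall>I J. ideal I R \<and> ideal J R \<and>
    ideal_prod R I J = {\<zero>\<^bsub>R\<^esub>} \<longrightarrow> I = {\<zero>\<^bsub>R\<^esub>} \<or> J = {\<zero>\<^bsub>R\<^esub>})"

definition hnp_ring :: "('a, 'r) ring_scheme \<Rightarrow> bool"
  where "hnp_ring R \<longleftrightarrow> ring R \<and> prime_ring R
    \<and> right_noetherian R \<and> right_noetherian (opposite_ring R)
    \<and> right_hereditary R \<and> right_hereditary (opposite_ring R)"

section \<open>The Goldie quotient ring\<close>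

definition regular_elements :: "('a, 'r) ring_scheme \<Rightarrow> 'a set"
  where "regular_elements R = {s \<in> carrier R. \<forall>x \<in> carrier R.
    (s \<otimes>\<^bsub>R\<^esub> x = \<zero>\<^bsub>R\<^esub> \<longrightarrow> x = \<zero>\<^bsub>R\<^esub>) \<and> (x \<otimes>\<^bsub>R\<^esub> s = \<zero>\<^bsub>R\<^esub> \<longrightarrow> x = \<zero>\<^bsub>R\<^esub>)}"

text \<open>
  \<open>Q\<close>, with the embedding \<open>\<phi>\<close>, is the two-sided ring of fractions of \<open>R\<close> with respect to all regular
  elements: every element of \<open>Q\<close> is both a right fraction \<open>a s\<inverse>\<close> and a left fraction \<open>t\<inverse> b\<close>.
  This determines \<open>(Q, \<phi>)\<close> up to unique isomorphism. That \<open>Q\<close> exists and is simple artinian when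
  \<open>R\<close> is prime noetherian is Goldie's theorem and is not part of the definition.
\<close>

definition goldie_quotient_ring ::
  "('a, 'r) ring_scheme \<Rightarrow> ('b, 'q) ring_scheme \<Rightarrow> ('a \<Rightarrow> 'b) \<Rightarrow> bool"
  where "goldie_quotient_ring R Q \<phi> \<longleftrightarrow>
    ring Q \<and> \<phi> \<in> ring_hom R Q \<and> inj_on \<phi> (carrier R) \<and>
    \<phi> ` regular_elements R \<subseteq> Units Q \<and>
    (\<forall>q \<in> carrier Q. \<exists>a \<in> carrier R. \<exists>s \<in> regular_elements R. q = \<phi> a \<otimes>\<^bsub>Q\<^esub> inv\<^bsub>Q\<^esub> (\<phi> s)) \<and>
    (\<forall>q \<in> carrier Q. \<exists>b \<in> carrier R. \<exists>t \<in> regular_elements R. q = inv\<^bsub>Q\<^esub> (\<phi> t) \<otimes>\<^bsub>Q\<^esub> \<phi> b)"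

section \<open>Affine algebras\<close>

definition ring_center :: "('a, 'r) ring_scheme \<Rightarrow> 'a set"
  where "ring_center R = {z \<in> carrier R. \<forall>x \<in> carrier R. z \<otimes>\<^bsub>R\<^esub> x = x \<otimes>\<^bsub>R\<^esub> z}"

text \<open>
  An associative unital, possibly noncommutative algebra \<open>A\<close> over a commutative ring \<open>C\<close>, given by
  its structure map \<open>\<psi>\<close>. (The library locale \<open>algebra\<close> requires \<open>A\<close> commutative.)
\<close>

definition assoc_algebra ::
  "('c, 'r) ring_scheme \<Rightarrow> ('a, 's) ring_scheme \<Rightarrow> ('c \<Rightarrow> 'a) \<Rightarrow> bool"
  where "assoc_algebra C A \<psi> \<longleftrightarrow>
    cring C \<and> ring A \<and> \<psi> \<in> ring_hom C A \<and> \<psi> ` carrier C \<subseteq> ring_center A"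

text \<open>The \<open>C\<close>-subalgebra generated by \<open>F\<close> is the subring generated by \<open>\<psi> ` carrier C \<union> F\<close>.\<close>

definition affine_algebra ::
  "('c, 'r) ring_scheme \<Rightarrow> ('a, 's) ring_scheme \<Rightarrow> ('c \<Rightarrow> 'a) \<Rightarrow> bool"
  where "affine_algebra C A \<psi> \<longleftrightarrow> assoc_algebra C A \<psi> \<and>
    (\<exists>F. finite F \<and> F \<subseteq> carrier A \<and> generate_ring A (\<psi> ` carrier C \<union> F) = carrier A)"

end

theory Submission
  imports Defs
begin

text \<open>
  The idea is that adjoining finitely many elements of \<open>Q\<close> to \<open>R\<close> inverts only those regular elements
  \<open>s\<close> for which the composition factors of \<open>R/sR\<close> come from a finite list of simple modules.

  Let \<open>\<M>\<close> be a set of maximal right ideals. Say that a right \<open>R\<close>-module extension \<open>A \<subseteq> B\<close> is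
  \<open>\<M>\<close>-torsion if it is filtered by finitely many steps \<open>A\<^sub>i \<subseteq> A\<^sub>i\<^sub>+\<^sub>1\<close> such that every nonzero element of
  \<open>A\<^sub>i\<^sub>+\<^sub>1/A\<^sub>i\<close> has its annihilator in \<open>\<M>\<close>. This relation survives intersection with a submodule, addition
  of a submodule and module homomorphisms. Hence the elements \<open>q\<close> of \<open>Q\<close> that lie in an \<open>\<M>\<close>-torsion
  extension of \<open>R\<close> form a subring of \<open>Q\<close> (\<open>torsion_subring\<close>): multiplying an extension of \<open>R\<close> from the left
  by \<open>p\<close> gives an extension of \<open>pR\<close>, which can be glued on top of an extension of \<open>R\<close> that contains \<open>p\<close>.

  Every \<open>q = t\<inverse> b\<close> lies in \<open>t\<inverse> R\<close>, and \<open>t\<inverse> R / R \<cong> R/tR\<close> has finite length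
  (\<open>finite_length_mod_regular\<close>). The ascending chain condition is given; the descending one comes
  from duality. A right ideal \<open>J\<close> that contains \<open>t\<close> is projective, and a dual basis shows that \<open>J\<close> can be
  recovered from \<open>J\<^sup>* = {q. q J \<subseteq> R}\<close>, which is a left submodule of the noetherian left module \<open>R t\<inverse>\<close>.
  So for finitely many elements \<open>q\<close> one may take for \<open>\<M>\<close> the annihilators of the nonzero elements of
  finitely many simple modules \<open>R/N\<close>.

  If \<open>R\<close> and these elements generate \<open>Q\<close>, then every \<open>s\<inverse>\<close> lies in the torsion subring. Multiplying an
  extension of \<open>R\<close> that contains \<open>s\<inverse>\<close> by \<open>s\<close> shows that \<open>R/sR\<close> is torsion. Now let \<open>S\<close> be a simple module
  and \<open>M\<close> the annihilator of a nonzero element of \<open>S\<close>. If \<open>M\<close> is an essential right ideal then it contains a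
  regular \<open>s\<close> (\<open>essential_contains_regular\<close>), so \<open>S \<cong> R/M\<close> is a quotient of \<open>R/sR\<close> and is one of
  these finitely many. If \<open>M\<close> is not essential then \<open>S\<close> embeds in \<open>R\<close> as a minimal right ideal, and since \<open>R\<close> is
  prime all such \<open>S\<close> are isomorphic. Altogether \<open>R\<close> has only finitely many simple modules.
\<close>

section \<open>Right modules and residuals\<close>

lemma right_regular_module_simps [simp]:
  "carrier (right_regular_module R) = carrier R"
  "\<zero>\<^bsub>right_regular_module R\<^esub> = \<zero>\<^bsub>R\<^esub>"
  "ring.add (right_regular_module R) = ring.add R"
  "module.smult (right_regular_module R) = (\<lambda>r x. x \<otimes>\<^bsub>R\<^esub> r)"
  by (simp_all add: right_regular_module_def)

text \<open>
  The right ideal \<open>(A : b)\<close>, that is, the annihilator of the coset of \<open>b\<close> in \<open>M/A\<close>.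
  Residuals take the place of quotient modules throughout: \<open>R/(A : b)\<close> is isomorphic to the
  submodule of \<open>M/A\<close> generated by \<open>b\<close>.
\<close>
definition residual ::
  "('a, 'r) ring_scheme \<Rightarrow> ('a, 'm, 'x) module_scheme \<Rightarrow> 'm set \<Rightarrow> 'm \<Rightarrow> 'a set"
  where "residual R M A b = {r \<in> carrier R. r \<odot>\<^bsub>M\<^esub> b \<in> A}"

definition maximal_right_ideal :: "'a set \<Rightarrow> ('a, 'r) ring_scheme \<Rightarrow> bool"
  where "maximal_right_ideal I R \<longleftrightarrow> right_ideal I R \<and> \<one>\<^bsub>R\<^esub> \<notin> I \<and>
    (\<forall>J. right_ideal J R \<and> I \<subseteq> J \<and> \<one>\<^bsub>R\<^esub> \<notin> J \<longrightarrow> J = I)"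

context right_module
begin

lemma ract_zero [simp]: "r \<in> carrier R \<Longrightarrow> r \<odot>\<^bsub>M\<^esub> \<zero>\<^bsub>M\<^esub> = \<zero>\<^bsub>M\<^esub>"
  using ract_distrib_add[of r "\<zero>\<^bsub>M\<^esub>" "\<zero>\<^bsub>M\<^esub>"] ract_closed[of r "\<zero>\<^bsub>M\<^esub>"]
  by (simp add: M.add.l_cancel_one)

lemma zero_ract [simp]: "x \<in> carrier M \<Longrightarrow> \<zero>\<^bsub>R\<^esub> \<odot>\<^bsub>M\<^esub> x = \<zero>\<^bsub>M\<^esub>"
  using ract_distrib_scalar[of "\<zero>\<^bsub>R\<^esub>" "\<zero>\<^bsub>R\<^esub>" x] ract_closed[of "\<zero>\<^bsub>R\<^esub>" x]
  by (simp add: M.add.l_cancel_one)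

lemma minus_ract:
  assumes "r \<in> carrier R" "x \<in> carrier M"
  shows "(\<ominus>\<^bsub>R\<^esub> r) \<odot>\<^bsub>M\<^esub> x = \<ominus>\<^bsub>M\<^esub> (r \<odot>\<^bsub>M\<^esub> x)"
proof (rule sym, rule M.minus_equality)
  show "((\<ominus>\<^bsub>R\<^esub> r) \<odot>\<^bsub>M\<^esub> x) \<oplus>\<^bsub>M\<^esub> (r \<odot>\<^bsub>M\<^esub> x) = \<zero>\<^bsub>M\<^esub>"
    using assms ract_distrib_scalar[of "\<ominus>\<^bsub>R\<^esub> r" r x] by (simp add: R.l_neg)
qed (use assms ract_closed in auto)

lemma submodule_iff:
  "submodule H R M \<longleftrightarrow> H \<subseteq> carrier M \<and> \<zero>\<^bsub>M\<^esub> \<in> H \<and>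
     (\<forall>x\<in>H. \<forall>y\<in>H. x \<oplus>\<^bsub>M\<^esub> y \<in> H) \<and> (\<forall>r\<in>carrier R. \<forall>x\<in>H. r \<odot>\<^bsub>M\<^esub> x \<in> H)"
    (is "_ \<longleftrightarrow> ?P")
proof
  assume "submodule H R M"
  then interpret submodule H R M .
  show ?P using subset m_closed one_closed smult_closed by auto
next
  assume P: ?P
  have "\<ominus>\<^bsub>M\<^esub> x \<in> H" if "x \<in> H" for x
    using P that minus_ract[of "\<one>\<^bsub>R\<^esub>" x] ract_one[of x] by (metis R.add.inv_closed R.one_closed subsetD)
  then show "submodule H R M"
    using P by (intro submodule.intro subgroup.intro) (auto simp: a_inv_def submodule_axioms_def)
qed

lemma submodule_minus:
  assumes "submodule H R M" "x \<in> H" "y \<in> H" shows "x \<ominus>\<^bsub>M\<^esub> y \<in> H"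
proof -
  have "(\<ominus>\<^bsub>R\<^esub> \<one>\<^bsub>R\<^esub>) \<odot>\<^bsub>M\<^esub> y = \<ominus>\<^bsub>M\<^esub> y"
    using assms submodule_iff minus_ract[of "\<one>\<^bsub>R\<^esub>" y] ract_one[of y] by auto
  then show ?thesis
    using assms submodule_iff unfolding a_minus_def by (metis R.add.inv_closed R.one_closed)
qed

lemma submodule_cancel_left:
  assumes "submodule H R M" "x \<in> H" "y \<in> carrier M" "x \<oplus>\<^bsub>M\<^esub> y \<in> H" shows "y \<in> H"
proof -
  have x: "x \<in> carrier M" using assms submodule_iff by auto
  have "(x \<oplus>\<^bsub>M\<^esub> y) \<ominus>\<^bsub>M\<^esub> x = y"
    using x assms(3) by (simp add: M.minus_eq M.a_assoc M.a_comm M.r_neg1 M.r_neg2)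
  then show ?thesis using submodule_minus[OF assms(1,4,2)] by simp
qed

end

lemma (in ring) right_regular_right_module: "right_module R (right_regular_module R)"
proof -
  have "abelian_group (right_regular_module R)"
    by (rule abelian_groupI) (auto simp: a_ac intro: l_neg)
  then show ?thesis
    by (auto simp: right_module_def right_module_axioms_def ring_axioms l_distr r_distr m_assoc)
qed

lemma (in ring) right_ideal_iff_submodule:
  "right_ideal I R \<longleftrightarrow> submodule I R (right_regular_module R)"
proof -
  interpret M: right_module R "right_regular_module R" by (rule right_regular_right_module)
  show ?thesis
  proof
    assume "right_ideal I R"
    then show "submodule I R (right_regular_module R)"
      unfolding M.submodule_iff right_ideal_def
      using additive_subgroup.a_subset additive_subgroup.zero_closed additive_subgroup.a_closed
      by fastforce
  next
    assume s: "submodule I R (right_regular_module R)"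
    have "\<ominus> x \<in> I" if "x \<in> I" for x
    proof -
      have "x \<otimes> (\<ominus> \<one>) = \<ominus> x" "x \<otimes> (\<ominus> \<one>) \<in> I"
        using s that unfolding M.submodule_iff by (auto simp: r_minus)
      then show ?thesis by simp
    qed
    with s show "right_ideal I R"
      unfolding M.submodule_iff right_ideal_def
      by (auto simp: a_inv_def intro!: additive_subgroupI subgroup.intro)
  qed
qed

lemma (in ring) right_ideal_iff:
  "right_ideal I R \<longleftrightarrow> I \<subseteq> carrier R \<and> \<zero> \<in> I \<and>
     (\<forall>x\<in>I. \<forall>y\<in>I. x \<oplus> y \<in> I) \<and> (\<forall>x\<in>I. \<forall>r\<in>carrier R. x \<otimes> r \<in> I)"
proof -
  interpret M: right_module R "right_regular_module R" by (rule right_regular_right_module)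
  show ?thesis
    unfolding right_ideal_iff_submodule M.submodule_iff by auto
qed

section \<open>Torsion extensions\<close>

text \<open>
  For a set \<open>\<M>\<close> of maximal right ideals, every nonzero cyclic submodule of \<open>B/A\<close> is a simple module
  \<open>R/I\<close> with \<open>I \<in> \<M>\<close>. The case \<open>A = B\<close> is included, so that intersecting or adding a submodule
  never has to distinguish whether a step collapses.
\<close>
definition factor_step ::
  "('a, 'r) ring_scheme \<Rightarrow> ('a, 'm, 'x) module_scheme \<Rightarrow> 'a set set \<Rightarrow> 'm set \<Rightarrow> 'm set \<Rightarrow> bool"
  where "factor_step R M \<M> A B \<longleftrightarrow> submodule A R M \<and> submodule B R M \<and> A \<subseteq> B
    \<and> (\<forall>b \<in> B - A. residual R M A b \<in> \<M>)"

abbreviation factor_chain ::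
  "('a, 'r) ring_scheme \<Rightarrow> ('a, 'm, 'x) module_scheme \<Rightarrow> 'a set set \<Rightarrow> 'm set \<Rightarrow> 'm set \<Rightarrow> bool"
  where "factor_chain R M \<M> \<equiv> (factor_step R M \<M>)\<^sup>*\<^sup>*"

lemma factor_chain_subset: "factor_chain R M \<M> A B \<Longrightarrow> A \<subseteq> B"
  by (induction rule: rtranclp_induct) (auto simp: factor_step_def)

lemma factor_chain_mono: "factor_chain R M \<M> A B \<Longrightarrow> \<M> \<subseteq> Y \<Longrightarrow> factor_chain R M Y A B"
  by (erule rtranclp_mono[THEN predicate2D, rotated]) (auto simp: factor_step_def subset_iff)

lemma factor_chain_submodule:
  "factor_chain R M \<M> A B \<Longrightarrow> submodule A R M \<Longrightarrow> submodule B R M"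
  by (induction rule: rtranclp_induct) (auto simp: factor_step_def)

lemma factor_chain_first:
  assumes "factor_chain R M \<M> A B" "A \<noteq> B"
  shows "\<exists>b\<in>B - A. residual R M A b \<in> \<M>"
  using assms
proof (induction rule: converse_rtranclp_induct)
  case (step A C)
  show ?case
  proof (cases "A = C")
    case False
    then show ?thesis using step(1) factor_chain_subset[OF step(2)]
      by (auto simp: factor_step_def)
  qed (use step in auto)
qed simp

context right_module
begin

lemma residual_right_ideal:
  assumes "submodule A R M" "b \<in> carrier M"
  shows "right_ideal (residual R M A b) R"
  using assms unfolding submodule_iff R.right_ideal_iff residual_def
  by (auto simp: ract_distrib_scalar ract_assoc)

lemma one_in_residual: "b \<in> carrier M \<Longrightarrow> \<one>\<^bsub>R\<^esub> \<in> residual R M A b \<longleftrightarrow> b \<in> A"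
  by (auto simp: residual_def ract_one)

lemma residual_ract:
  assumes "b \<in> carrier M" "r \<in> carrier R"
  shows "residual R M A (r \<odot>\<^bsub>M\<^esub> b) = residual R (right_regular_module R) (residual R M A b) r"
  using assms by (auto simp: residual_def ract_assoc)

lemma submodule_Int:
  "submodule A R M \<Longrightarrow> submodule B R M \<Longrightarrow> submodule (A \<inter> B) R M"
  unfolding submodule_iff by auto

lemma submodule_sum:
  assumes "submodule A R M" "submodule B R M" shows "submodule (A <+>\<^bsub>M\<^esub> B) R M"
proof -
  have 1: "A <+>\<^bsub>M\<^esub> B = {a \<oplus>\<^bsub>M\<^esub> b | a b. a \<in> A \<and> b \<in> B}" by (auto simp: set_add_def')
  have "\<exists>c d. (a \<oplus>\<^bsub>M\<^esub> b) \<oplus>\<^bsub>M\<^esub> (a' \<oplus>\<^bsub>M\<^esub> b') = c \<oplus>\<^bsub>M\<^esub> d \<and> c \<in> A \<and> d \<in> B"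
    if "a \<in> A" "b \<in> B" "a' \<in> A" "b' \<in> B" for a b a' b'
  proof (intro exI conjI)
    show "(a \<oplus>\<^bsub>M\<^esub> b) \<oplus>\<^bsub>M\<^esub> (a' \<oplus>\<^bsub>M\<^esub> b') = (a \<oplus>\<^bsub>M\<^esub> a') \<oplus>\<^bsub>M\<^esub> (b \<oplus>\<^bsub>M\<^esub> b')"
      using that assms unfolding submodule_iff by (simp add: M.a_ac subset_iff)
  qed (use that assms in \<open>auto simp: submodule_iff\<close>)
  moreover have "\<exists>c d. r \<odot>\<^bsub>M\<^esub> (a \<oplus>\<^bsub>M\<^esub> b) = c \<oplus>\<^bsub>M\<^esub> d \<and> c \<in> A \<and> d \<in> B"
    if "a \<in> A" "b \<in> B" "r \<in> carrier R" for a b r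
    using that assms ract_distrib_add[of r a b] unfolding submodule_iff by blast
  moreover have "\<exists>c d. \<zero>\<^bsub>M\<^esub> = c \<oplus>\<^bsub>M\<^esub> d \<and> c \<in> A \<and> d \<in> B"
    using assms unfolding submodule_iff by (metis M.l_zero M.zero_closed)
  ultimately show ?thesis
    using assms unfolding 1 submodule_iff[of "{_. _}"] by (auto simp: submodule_iff)
qed

lemma submodule_sum_absorb:
  assumes "submodule A R M" "submodule B R M" "A \<subseteq> B" shows "B <+>\<^bsub>M\<^esub> A = B"
proof
  show "B <+>\<^bsub>M\<^esub> A \<subseteq> B" using assms unfolding submodule_iff set_add_def' by auto
  show "B \<subseteq> B <+>\<^bsub>M\<^esub> A"
  proof
    fix b assume "b \<in> B"
    moreover have "\<zero>\<^bsub>M\<^esub> \<in> A" "b \<oplus>\<^bsub>M\<^esub> \<zero>\<^bsub>M\<^esub> = b" using assms \<open>b \<in> B\<close> by (auto simp: submodule_iff)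
    ultimately show "b \<in> B <+>\<^bsub>M\<^esub> A" unfolding set_add_def' by force
  qed
qed

lemma factor_chain_Int:
  assumes "factor_chain R M \<M> A B" "submodule C R M"
  shows "factor_chain R M \<M> (A \<inter> C) (B \<inter> C)"
  using assms(1)
proof (induction rule: rtranclp_induct)
  case (step B D)
  have "residual R M (B \<inter> C) b = residual R M B b" if "b \<in> C" for b
    using that assms(2) by (auto simp: residual_def submodule_iff)
  then have "factor_step R M \<M> (B \<inter> C) (D \<inter> C)"
    using step(2) assms(2) submodule_Int by (auto simp: factor_step_def)
  with step(3) show ?case by simp
qed simp

text \<open>
  Maximality of the right ideals in \<open>\<M>\<close> is what makes torsion extensions stable: a nonzero image of a
  simple cyclic module has the same annihilator.
\<close>
lemma maximal_residual_eqI: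
  assumes "maximal_right_ideal (residual R M A b) R" "submodule C R M" "c \<in> carrier M" "c \<notin> C"
    and "residual R M A b \<subseteq> residual R M C c"
  shows "residual R M C c = residual R M A b"
  using assms residual_right_ideal one_in_residual unfolding maximal_right_ideal_def by blast

text \<open>
  A coset of \<open>C + B\<close> that is represented by \<open>c + b\<close> is killed by whatever kills \<open>b\<close> modulo \<open>B\<close>.
\<close>
lemma factor_chain_add:
  assumes "factor_chain R M \<M> A B" "submodule C R M" "\<forall>I\<in>\<M>. maximal_right_ideal I R"
  shows "factor_chain R M \<M> (C <+>\<^bsub>M\<^esub> A) (C <+>\<^bsub>M\<^esub> B)"
  using assms(1)
proof (induction rule: rtranclp_induct)
  case (step B D)
  have sub: "submodule B R M" "submodule D R M" "B \<subseteq> D" using step(2) by (auto simp: factor_step_def)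
  have "residual R M (C <+>\<^bsub>M\<^esub> B) x \<in> \<M>" if x: "x \<in> C <+>\<^bsub>M\<^esub> D" "x \<notin> C <+>\<^bsub>M\<^esub> B" for x
  proof -
    from x obtain c b where cb: "c \<in> C" "b \<in> D" "x = c \<oplus>\<^bsub>M\<^esub> b" unfolding set_add_def' by auto
    have b: "b \<notin> B" using x(2) cb unfolding set_add_def' by auto
    have car: "c \<in> carrier M" "b \<in> carrier M" "x \<in> carrier M"
      using cb sub assms(2) by (auto simp: submodule_iff)
    have \<M>: "residual R M B b \<in> \<M>" using step(2) cb b by (auto simp: factor_step_def)
    have "residual R M B b \<subseteq> residual R M (C <+>\<^bsub>M\<^esub> B) x"
    proof
      fix r assume r: "r \<in> residual R M B b"
      then have "r \<odot>\<^bsub>M\<^esub> x = r \<odot>\<^bsub>M\<^esub> c \<oplus>\<^bsub>M\<^esub> r \<odot>\<^bsub>M\<^esub> b" "r \<odot>\<^bsub>M\<^esub> c \<in> C"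
        using cb car assms(2) by (auto simp: residual_def ract_distrib_add submodule_iff)
      then show "r \<in> residual R M (C <+>\<^bsub>M\<^esub> B) x" using r unfolding residual_def set_add_def' by auto
    qed
    then have "residual R M (C <+>\<^bsub>M\<^esub> B) x = residual R M B b"
      using assms(3) \<M> car x submodule_sum[OF assms(2) sub(1)] by (intro maximal_residual_eqI) auto
    with \<M> show ?thesis by simp
  qed
  moreover have "C <+>\<^bsub>M\<^esub> B \<subseteq> C <+>\<^bsub>M\<^esub> D" using sub(3) unfolding set_add_def' by auto
  ultimately have "factor_step R M \<M> (C <+>\<^bsub>M\<^esub> B) (C <+>\<^bsub>M\<^esub> D)"
    using sub assms(2) submodule_sum by (auto simp: factor_step_def)
  with step(3) show ?case by simp
qed simp

end

lemma rmod_hom_zero: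
  assumes "right_module R M" "right_module R N" "f \<in> rmod_hom R M N"
  shows "f \<zero>\<^bsub>M\<^esub> = \<zero>\<^bsub>N\<^esub>"
proof -
  interpret M: right_module R M by fact
  interpret N: right_module R N by fact
  have "f (\<zero>\<^bsub>R\<^esub> \<odot>\<^bsub>M\<^esub> \<zero>\<^bsub>M\<^esub>) = \<zero>\<^bsub>R\<^esub> \<odot>\<^bsub>N\<^esub> f \<zero>\<^bsub>M\<^esub>" "f \<zero>\<^bsub>M\<^esub> \<in> carrier N"
    using assms(3) M.R.zero_closed M.M.zero_closed unfolding rmod_hom_def by blast+
  then show ?thesis by simp
qed

lemma rmod_hom_image_submodule:
  assumes "right_module R M" "right_module R N" "f \<in> rmod_hom R M N" "submodule A R M"
  shows "submodule (f ` A) R N"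
proof -
  interpret M: right_module R M by fact
  interpret N: right_module R N by fact
  have A: "A \<subseteq> carrier M" using assms by (simp add: M.submodule_iff)
  have "f x \<oplus>\<^bsub>N\<^esub> f y \<in> f ` A" if "x \<in> A" "y \<in> A" for x y
  proof -
    have "f x \<oplus>\<^bsub>N\<^esub> f y = f (x \<oplus>\<^bsub>M\<^esub> y)" using that A assms(3) by (auto simp: rmod_hom_def subset_iff)
    then show ?thesis using that assms(4) by (simp add: M.submodule_iff)
  qed
  moreover have "r \<odot>\<^bsub>N\<^esub> f x \<in> f ` A" if "x \<in> A" "r \<in> carrier R" for x r
  proof -
    have "r \<odot>\<^bsub>N\<^esub> f x = f (r \<odot>\<^bsub>M\<^esub> x)" using that A assms(3) by (auto simp: rmod_hom_def subset_iff)
    then show ?thesis using that assms(4) by (simp add: M.submodule_iff)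
  qed
  moreover have "\<zero>\<^bsub>N\<^esub> \<in> f ` A"
    using rmod_hom_zero[OF assms(1-3)] assms(4) unfolding M.submodule_iff by (metis imageI)
  ultimately show ?thesis
    using A assms(3) by (auto simp: N.submodule_iff rmod_hom_def)
qed

lemma factor_chain_image:
  assumes "right_module R M" "right_module R N" "f \<in> rmod_hom R M N"
    and "factor_chain R M \<M> A B" "\<forall>I\<in>\<M>. maximal_right_ideal I R"
  shows "factor_chain R N \<M> (f ` A) (f ` B)"
  using assms(4)
proof (induction rule: rtranclp_induct)
  case (step B D)
  interpret M: right_module R M by fact
  interpret N: right_module R N by fact
  have sub: "submodule B R M" "submodule D R M" "B \<subseteq> D" using step(2) by (auto simp: factor_step_def)
  then have sub': "submodule (f ` B) R N" "submodule (f ` D) R N"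
    using rmod_hom_image_submodule[OF assms(1-3)] by auto
  have "residual R N (f ` B) (f d) \<in> \<M>" if d: "d \<in> D" "f d \<notin> f ` B" for d
  proof -
    have car: "d \<in> carrier M" "f d \<in> carrier N" using sub d sub' by (auto simp: M.submodule_iff N.submodule_iff)
    have \<M>: "residual R M B d \<in> \<M>" using d step(2) by (auto simp: factor_step_def)
    have "residual R M B d \<subseteq> residual R N (f ` B) (f d)"
      using assms(3) car by (auto simp: residual_def rmod_hom_def intro: rev_image_eqI)
    moreover have "maximal_right_ideal (residual R M B d) R" using assms(5) \<M> by auto
    ultimately have "residual R N (f ` B) (f d) = residual R M B d"
      using N.residual_right_ideal[OF sub'(1) car(2)] N.one_in_residual[OF car(2), of "f ` B"] d
      unfolding maximal_right_ideal_def by blast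
    with \<M> show ?thesis by simp
  qed
  with sub sub' have "factor_step R N \<M> (f ` B) (f ` D)" by (auto simp: factor_step_def)
  with step(3) show ?case by simp
qed simp

section \<open>Simple modules and their annihilators\<close>

text \<open>
  The annihilators of the nonzero elements of the modules \<open>R/N\<close> with \<open>N \<in> F\<close>.
\<close>
definition right_translates :: "('a, 'r) ring_scheme \<Rightarrow> 'a set set \<Rightarrow> 'a set set"
  where "right_translates R F =
    {residual R (right_regular_module R) N r | N r. N \<in> F \<and> r \<in> carrier R - N}"

definition essential_right_ideal :: "'a set \<Rightarrow> ('a, 'r) ring_scheme \<Rightarrow> bool"
  where "essential_right_ideal I R \<longleftrightarrow> right_ideal I R \<and>
    (\<forall>K. right_ideal K R \<and> K \<inter> I = {\<zero>\<^bsub>R\<^esub>} \<longrightarrow> K = {\<zero>\<^bsub>R\<^esub>})"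

lemma (in abelian_group) diff_eq_zero_iff:
  assumes "x \<in> carrier G" "y \<in> carrier G" shows "x \<ominus> y = \<zero> \<longleftrightarrow> x = y"
  using assms by (metis a_minus_def a_inv_closed minus_equality minus_minus r_neg)

context right_module
begin

lemma cyclic_submodule:
  assumes "b \<in> carrier M" shows "submodule {r \<odot>\<^bsub>M\<^esub> b | r. r \<in> carrier R} R M"
proof -
  have "\<exists>t. r \<odot>\<^bsub>M\<^esub> b \<oplus>\<^bsub>M\<^esub> s \<odot>\<^bsub>M\<^esub> b = t \<odot>\<^bsub>M\<^esub> b \<and> t \<in> carrier R"
    if "r \<in> carrier R" "s \<in> carrier R" for r s
    using that assms by (intro exI[of _ "r \<oplus>\<^bsub>R\<^esub> s"]) (simp add: ract_distrib_scalar)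
  moreover have "\<exists>t. s \<odot>\<^bsub>M\<^esub> (r \<odot>\<^bsub>M\<^esub> b) = t \<odot>\<^bsub>M\<^esub> b \<and> t \<in> carrier R"
    if "r \<in> carrier R" "s \<in> carrier R" for r s
    using that assms by (intro exI[of _ "r \<otimes>\<^bsub>R\<^esub> s"]) (simp add: ract_assoc)
  moreover have "\<exists>t. \<zero>\<^bsub>M\<^esub> = t \<odot>\<^bsub>M\<^esub> b \<and> t \<in> carrier R"
    using assms by (intro exI[of _ "\<zero>\<^bsub>R\<^esub>"]) simp
  ultimately show ?thesis
    unfolding submodule_iff using assms ract_closed by blast
qed

text \<open>
  If \<open>B/A\<close> is simple then any \<open>b \<in> B - A\<close> generates it. Applied to \<open>b r\<close> with \<open>r \<notin> (A : b)\<close> this yields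
  \<open>b \<in> A + b r R\<close>, so \<open>1 \<in> (A : b) + r R\<close>, which is maximality of \<open>(A : b)\<close>.
\<close>
lemma minimal_overmodule:
  assumes A: "submodule A R M" and B: "submodule B R M" "A \<subseteq> B"
    and minimal: "\<And>C. submodule C R M \<Longrightarrow> A \<subseteq> C \<Longrightarrow> C \<subseteq> B \<Longrightarrow> C = A \<or> C = B"
    and b: "b \<in> B" "b \<notin> A"
  shows "\<And>c. c \<in> B \<Longrightarrow> \<exists>a\<in>A. \<exists>r\<in>carrier R. c = a \<oplus>\<^bsub>M\<^esub> r \<odot>\<^bsub>M\<^esub> b"
    and "maximal_right_ideal (residual R M A b) R"
proof -
  have cyc: "\<exists>a\<in>A. \<exists>r\<in>carrier R. c = a \<oplus>\<^bsub>M\<^esub> r \<odot>\<^bsub>M\<^esub> b" if b: "b \<in> B" "b \<notin> A" and c: "c \<in> B" for b c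
  proof -
    define C where "C = A <+>\<^bsub>M\<^esub> {r \<odot>\<^bsub>M\<^esub> b | r. r \<in> carrier R}"
    have bM: "b \<in> carrier M" using b B by (auto simp: submodule_iff)
    have C: "submodule C R M" unfolding C_def by (intro submodule_sum A cyclic_submodule bM)
    have zA: "\<zero>\<^bsub>M\<^esub> \<in> A" "A \<subseteq> carrier M" using A by (auto simp: submodule_iff)
    have "a = a \<oplus>\<^bsub>M\<^esub> \<zero>\<^bsub>R\<^esub> \<odot>\<^bsub>M\<^esub> b" if "a \<in> A" for a using that zA bM by auto
    then have AC: "A \<subseteq> C" unfolding C_def set_add_def' by blast
    have "b = \<zero>\<^bsub>M\<^esub> \<oplus>\<^bsub>M\<^esub> \<one>\<^bsub>R\<^esub> \<odot>\<^bsub>M\<^esub> b" using bM by (simp add: ract_one)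
    then have bC: "b \<in> C" using zA unfolding C_def set_add_def' by blast
    have "C \<subseteq> B" using b B A unfolding C_def set_add_def' submodule_iff by blast
    then have "C = B" using minimal[OF C AC] bC b by auto
    with c show ?thesis unfolding C_def set_add_def' by auto
  qed
  then show "\<And>c. c \<in> B \<Longrightarrow> \<exists>a\<in>A. \<exists>r\<in>carrier R. c = a \<oplus>\<^bsub>M\<^esub> r \<odot>\<^bsub>M\<^esub> b" using b by blast
  have bM: "b \<in> carrier M" using b B by (auto simp: submodule_iff)
  let ?N = "residual R M A b"
  have "J = ?N" if J: "right_ideal J R" "?N \<subseteq> J" "\<one>\<^bsub>R\<^esub> \<notin> J" for J
  proof (rule ccontr)
    assume "J \<noteq> ?N"
    then obtain r where r: "r \<in> J" "r \<notin> ?N" using J by auto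
    have rR: "r \<in> carrier R" using r J by (auto simp: R.right_ideal_iff)
    have "r \<odot>\<^bsub>M\<^esub> b \<in> B" "r \<odot>\<^bsub>M\<^esub> b \<notin> A"
      using r rR b B by (auto simp: residual_def submodule_iff)
    then obtain a u where au: "a \<in> A" "u \<in> carrier R" "b = a \<oplus>\<^bsub>M\<^esub> u \<odot>\<^bsub>M\<^esub> (r \<odot>\<^bsub>M\<^esub> b)"
      using cyc b(1) by blast
    have aM: "a \<in> carrier M" using au A by (auto simp: submodule_iff)
    define w where "w = r \<otimes>\<^bsub>R\<^esub> u"
    have w: "w \<in> carrier R" "w \<in> J" using rR au r J by (auto simp: w_def R.right_ideal_iff)
    have eq: "b = a \<oplus>\<^bsub>M\<^esub> w \<odot>\<^bsub>M\<^esub> b" using au rR bM by (simp add: w_def ract_assoc)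
    have "(\<one>\<^bsub>R\<^esub> \<ominus>\<^bsub>R\<^esub> w) \<odot>\<^bsub>M\<^esub> b = b \<ominus>\<^bsub>M\<^esub> w \<odot>\<^bsub>M\<^esub> b"
      using w bM by (simp add: R.minus_eq M.minus_eq ract_distrib_scalar minus_ract ract_one)
    also have "\<dots> = a"
      using eq aM bM w ract_closed[of w b]
      by (metis M.a_assoc M.a_closed M.a_inv_closed M.minus_eq M.r_neg M.r_zero)
    finally have "\<one>\<^bsub>R\<^esub> \<ominus>\<^bsub>R\<^esub> w \<in> J" using J(2) au(1) w by (auto simp: residual_def)
    then have "(\<one>\<^bsub>R\<^esub> \<ominus>\<^bsub>R\<^esub> w) \<oplus>\<^bsub>R\<^esub> w \<in> J" using w J by (auto simp: R.right_ideal_iff)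
    moreover have "(\<one>\<^bsub>R\<^esub> \<ominus>\<^bsub>R\<^esub> w) \<oplus>\<^bsub>R\<^esub> w = \<one>\<^bsub>R\<^esub>" using w by (simp add: R.minus_eq R.a_assoc R.l_neg)
    ultimately show False using J(3) by simp
  qed
  then show "maximal_right_ideal ?N R"
    unfolding maximal_right_ideal_def using residual_right_ideal[OF A bM] one_in_residual[OF bM] b by auto
qed

text \<open>
  The map \<open>r \<mapsto> x r\<close> is injective on \<open>K\<close>, so \<open>x n\<close> and \<open>n\<close> have the same annihilator.
\<close>
lemma residual_ract_of_disjoint:
  assumes "x \<in> carrier M" "right_ideal K R" "K \<inter> residual R M {\<zero>\<^bsub>M\<^esub>} x = {\<zero>\<^bsub>R\<^esub>}" "n \<in> K"
  shows "residual R M {\<zero>\<^bsub>M\<^esub>} (n \<odot>\<^bsub>M\<^esub> x) = residual R (right_regular_module R) {\<zero>\<^bsub>R\<^esub>} n"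
proof -
  have n: "n \<in> carrier R" using assms by (auto simp: R.right_ideal_iff)
  have "n \<otimes>\<^bsub>R\<^esub> r \<in> residual R M {\<zero>\<^bsub>M\<^esub>} x \<longleftrightarrow> n \<otimes>\<^bsub>R\<^esub> r = \<zero>\<^bsub>R\<^esub>" if r: "r \<in> carrier R" for r
  proof -
    have "n \<otimes>\<^bsub>R\<^esub> r \<in> K" using r assms by (auto simp: R.right_ideal_iff)
    then show ?thesis using assms(3) by auto
  qed
  then show ?thesis
    unfolding residual_ract[OF assms(1) n] by (simp add: residual_def[of R "right_regular_module R"] cong: conj_cong)
qed

lemma residual_coset:
  assumes "submodule A R M" "a \<in> A" "b \<in> carrier M"
  shows "residual R M A (a \<oplus>\<^bsub>M\<^esub> b) = residual R M A b"
proof -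
  have aM: "a \<in> carrier M" using assms by (auto simp: submodule_iff)
  have "r \<odot>\<^bsub>M\<^esub> (a \<oplus>\<^bsub>M\<^esub> b) \<in> A \<longleftrightarrow> r \<odot>\<^bsub>M\<^esub> b \<in> A" if r: "r \<in> carrier R" for r
  proof -
    have "r \<odot>\<^bsub>M\<^esub> (a \<oplus>\<^bsub>M\<^esub> b) = r \<odot>\<^bsub>M\<^esub> a \<oplus>\<^bsub>M\<^esub> r \<odot>\<^bsub>M\<^esub> b" "r \<odot>\<^bsub>M\<^esub> a \<in> A"
      using r aM assms by (auto simp: ract_distrib_add submodule_iff)
    moreover have "r \<odot>\<^bsub>M\<^esub> b \<in> carrier M" using r assms(3) by (rule ract_closed)
    ultimately show ?thesis
      using submodule_cancel_left[OF assms(1), of "r \<odot>\<^bsub>M\<^esub> a"] assms(1) unfolding submodule_iff by metis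
  qed
  then show ?thesis by (auto simp: residual_def)
qed

text \<open>
  All nonzero elements of the simple module \<open>B/A\<close> are multiples of a single one, so their annihilators are
  the translates of a single maximal right ideal.
\<close>
lemma minimal_overmodule_factor_step:
  assumes A: "submodule A R M" and B: "submodule B R M" "A \<subset> B"
    and minimal: "\<And>C. submodule C R M \<Longrightarrow> A \<subseteq> C \<Longrightarrow> C \<subseteq> B \<Longrightarrow> C = A \<or> C = B"
  shows "\<exists>N. maximal_right_ideal N R \<and> factor_step R M (right_translates R {N}) A B"
proof -
  obtain b where b: "b \<in> B" "b \<notin> A" using B by auto
  let ?N = "residual R M A b"
  have AB: "A \<subseteq> B" using B by auto
  have bM: "b \<in> carrier M" using b B by (auto simp: submodule_iff)
  have "residual R M A c \<in> right_translates R {?N}" if c: "c \<in> B" "c \<notin> A" for c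
  proof -
    obtain a r where ar: "a \<in> A" "r \<in> carrier R" "c = a \<oplus>\<^bsub>M\<^esub> r \<odot>\<^bsub>M\<^esub> b"
      using minimal_overmodule(1)[OF A B(1) AB minimal b c(1)] by blast
    have "r \<notin> ?N" using ar c A by (auto simp: residual_def submodule_iff)
    moreover have "residual R M A c = residual R (right_regular_module R) ?N r"
      using residual_coset[OF A ar(1), of "r \<odot>\<^bsub>M\<^esub> b"] ar bM residual_ract[of b r] ract_closed by simp
    ultimately show ?thesis using ar unfolding right_translates_def by blast
  qed
  then have "factor_step R M (right_translates R {?N}) A B"
    using A B AB by (simp add: factor_step_def)
  then show ?thesis using minimal_overmodule(2)[OF A B(1) AB minimal b] by blast
qed

end

context ring
begin

lemma maximal_right_ideal_cyclic:
  assumes N: "maximal_right_ideal N R" and r: "r \<in> carrier R" "r \<notin> N"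
  shows "\<And>c. c \<in> carrier R \<Longrightarrow> \<exists>a\<in>N. \<exists>u\<in>carrier R. c = a \<oplus> r \<otimes> u"
    and "maximal_right_ideal (residual R (right_regular_module R) N r) R"
proof -
  interpret M: right_module R "right_regular_module R" by (rule right_regular_right_module)
  have sub: "submodule N R (right_regular_module R)" "submodule (carrier R) R (right_regular_module R)"
    "N \<subseteq> carrier R"
    using N by (auto simp: maximal_right_ideal_def right_ideal_iff_submodule M.submodule_iff)
  have minimal: "C = N \<or> C = carrier R" if "submodule C R (right_regular_module R)" "N \<subseteq> C" for C
  proof (cases "\<one> \<in> C")
    case True
    then have "x \<in> C" if "x \<in> carrier R" for x
      using \<open>submodule C R _\<close> that unfolding M.submodule_iff right_regular_module_simps by (metis l_one)
    then show ?thesis using \<open>submodule C R _\<close> unfolding M.submodule_iff by auto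
  next
    case False
    then show ?thesis using that N by (auto simp: maximal_right_ideal_def right_ideal_iff_submodule)
  qed
  show "\<exists>a\<in>N. \<exists>u\<in>carrier R. c = a \<oplus> r \<otimes> u" if "c \<in> carrier R" for c
    using M.minimal_overmodule(1)[OF sub minimal r that] by simp
  show "maximal_right_ideal (residual R (right_regular_module R) N r) R"
    using M.minimal_overmodule(2)[OF sub minimal r] .
qed

lemma right_translates_maximal:
  "\<forall>N\<in>F. maximal_right_ideal N R \<Longrightarrow> \<forall>I\<in>right_translates R F. maximal_right_ideal I R"
  using maximal_right_ideal_cyclic(2) unfolding right_translates_def by blast

end

lemma right_translates_mono: "F \<subseteq> G \<Longrightarrow> right_translates R F \<subseteq> right_translates R G"
  unfolding right_translates_def by blast

lemma simple_module_generator: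
  assumes "simple_right_module R S" "x \<in> carrier S" "x \<noteq> \<zero>\<^bsub>S\<^esub>"
  shows "\<And>y. y \<in> carrier S \<Longrightarrow> \<exists>r\<in>carrier R. y = r \<odot>\<^bsub>S\<^esub> x"
    and "maximal_right_ideal (residual R S {\<zero>\<^bsub>S\<^esub>} x) R"
proof -
  interpret S: right_module R S using assms by (simp add: simple_right_module_def)
  have sub: "submodule {\<zero>\<^bsub>S\<^esub>} R S" "submodule (carrier S) R S" "{\<zero>\<^bsub>S\<^esub>} \<subseteq> carrier S"
    by (auto simp: S.submodule_iff S.ract_closed)
  have minimal: "C = {\<zero>\<^bsub>S\<^esub>} \<or> C = carrier S" if "submodule C R S" for C
    using that assms by (auto simp: simple_right_module_def)
  have x: "x \<notin> {\<zero>\<^bsub>S\<^esub>}" using assms by auto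
  show "\<exists>r\<in>carrier R. y = r \<odot>\<^bsub>S\<^esub> x" if "y \<in> carrier S" for y
    using S.minimal_overmodule(1)[OF sub minimal assms(2) x that] assms(2) S.ract_closed by auto
  show "maximal_right_ideal (residual R S {\<zero>\<^bsub>S\<^esub>} x) R"
    using S.minimal_overmodule(2)[OF sub minimal assms(2) x] .
qed

text \<open>
  Both modules are isomorphic to \<open>R\<close> modulo the common annihilator; the isomorphism is \<open>x r \<mapsto> y r\<close>.
\<close>
lemma simple_modules_iso:
  assumes S: "simple_right_module R S" "x \<in> carrier S" "x \<noteq> \<zero>\<^bsub>S\<^esub>"
    and T: "simple_right_module R T" "y \<in> carrier T" "y \<noteq> \<zero>\<^bsub>T\<^esub>"
    and eq: "residual R S {\<zero>\<^bsub>S\<^esub>} x = residual R T {\<zero>\<^bsub>T\<^esub>} y"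
  shows "rmod_iso R S T"
proof -
  interpret S: right_module R S using S by (simp add: simple_right_module_def)
  interpret T: right_module R T using T by (simp add: simple_right_module_def)
  have key: "r \<odot>\<^bsub>S\<^esub> x = s \<odot>\<^bsub>S\<^esub> x \<longleftrightarrow> r \<odot>\<^bsub>T\<^esub> y = s \<odot>\<^bsub>T\<^esub> y" if "r \<in> carrier R" "s \<in> carrier R" for r s
  proof -
    have "r \<odot>\<^bsub>S\<^esub> x = s \<odot>\<^bsub>S\<^esub> x \<longleftrightarrow> (r \<ominus>\<^bsub>R\<^esub> s) \<odot>\<^bsub>S\<^esub> x = \<zero>\<^bsub>S\<^esub>"
      using that S by (simp add: S.R.minus_eq S.ract_distrib_scalar S.minus_ract S.ract_closed
          S.M.diff_eq_zero_iff flip: S.M.minus_eq)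
    moreover have "r \<odot>\<^bsub>T\<^esub> y = s \<odot>\<^bsub>T\<^esub> y \<longleftrightarrow> (r \<ominus>\<^bsub>R\<^esub> s) \<odot>\<^bsub>T\<^esub> y = \<zero>\<^bsub>T\<^esub>"
      using that T by (simp add: S.R.minus_eq T.ract_distrib_scalar T.minus_ract T.ract_closed
          T.M.diff_eq_zero_iff flip: T.M.minus_eq)
    moreover have "r \<ominus>\<^bsub>R\<^esub> s \<in> carrier R" using that by simp
    ultimately show ?thesis using eq by (auto simp: residual_def)
  qed
  define f where "f v = (SOME r. r \<in> carrier R \<and> v = r \<odot>\<^bsub>S\<^esub> x) \<odot>\<^bsub>T\<^esub> y" for v
  have f: "f (r \<odot>\<^bsub>S\<^esub> x) = r \<odot>\<^bsub>T\<^esub> y" if r: "r \<in> carrier R" for r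
  proof -
    let ?s = "SOME s. s \<in> carrier R \<and> r \<odot>\<^bsub>S\<^esub> x = s \<odot>\<^bsub>S\<^esub> x"
    have "?s \<in> carrier R \<and> r \<odot>\<^bsub>S\<^esub> x = ?s \<odot>\<^bsub>S\<^esub> x" by (rule someI) (use r in auto)
    then show ?thesis unfolding f_def using key[OF r, of ?s] by simp
  qed
  note genS = simple_module_generator(1)[OF S]
  note genT = simple_module_generator(1)[OF T]
  have hom: "f \<in> rmod_hom R S T"
    unfolding rmod_hom_def
  proof (intro CollectI conjI ballI)
    show "f \<in> carrier S \<rightarrow> carrier T"
    proof
      fix v assume "v \<in> carrier S"
      then obtain r where "r \<in> carrier R" "v = r \<odot>\<^bsub>S\<^esub> x" using genS by blast
      then show "f v \<in> carrier T" using f T.ract_closed T(2) by simp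
    qed
    show "f (v \<oplus>\<^bsub>S\<^esub> w) = f v \<oplus>\<^bsub>T\<^esub> f w" if v: "v \<in> carrier S" and w: "w \<in> carrier S" for v w
    proof -
      obtain r s where "r \<in> carrier R" "s \<in> carrier R" "v = r \<odot>\<^bsub>S\<^esub> x" "w = s \<odot>\<^bsub>S\<^esub> x"
        using genS v w by meson
      then show ?thesis using S T f[of "r \<oplus>\<^bsub>R\<^esub> s"]
        by (simp add: f S.ract_distrib_scalar T.ract_distrib_scalar)
    qed
    show "f (a \<odot>\<^bsub>S\<^esub> v) = a \<odot>\<^bsub>T\<^esub> f v" if a: "a \<in> carrier R" and v: "v \<in> carrier S" for a v
    proof -
      obtain r where "r \<in> carrier R" "v = r \<odot>\<^bsub>S\<^esub> x" using genS v by meson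
      then show ?thesis using a S T f[of "r \<otimes>\<^bsub>R\<^esub> a"] by (simp add: f S.ract_assoc T.ract_assoc)
    qed
  qed
  moreover have "bij_betw f (carrier S) (carrier T)"
  proof (rule bij_betw_imageI)
    show "inj_on f (carrier S)"
    proof (rule inj_onI)
      fix v w assume "v \<in> carrier S" "w \<in> carrier S" "f v = f w"
      moreover obtain r s where "r \<in> carrier R" "s \<in> carrier R" "v = r \<odot>\<^bsub>S\<^esub> x" "w = s \<odot>\<^bsub>S\<^esub> x"
        using genS calculation(1,2) by meson
      ultimately show "v = w" using key f by simp
    qed
    show "f ` carrier S = carrier T"
    proof
      show "f ` carrier S \<subseteq> carrier T" using hom by (auto simp: rmod_hom_def)
      show "carrier T \<subseteq> f ` carrier S"
      proof
        fix w assume "w \<in> carrier T"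
        then obtain r where r: "r \<in> carrier R" "w = r \<odot>\<^bsub>T\<^esub> y" using genT by blast
        show "w \<in> f ` carrier S"
          using f[OF r(1)] r(2) S.ract_closed[OF r(1) S(2)] by (intro image_eqI[of _ _ "r \<odot>\<^bsub>S\<^esub> x"]) simp_all
      qed
    qed
  qed
  ultimately show ?thesis unfolding rmod_iso_def by blast
qed

text \<open>
  Both modules are isomorphic to \<open>R/N\<close>. If the annihilators are \<open>(N : r)\<close> and \<open>(N : s)\<close>, then
  \<open>s \<in> N + r u\<close> for some \<open>u\<close>, because \<open>R/N\<close> is simple, and \<open>x u\<close> has the annihilator \<open>(N : s)\<close> of \<open>y\<close>.
\<close>
lemma simple_modules_iso_translate:
  assumes N: "maximal_right_ideal N R"
    and S: "simple_right_module R S" "x \<in> carrier S" "residual R S {\<zero>\<^bsub>S\<^esub>} x \<in> right_translates R {N}"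
    and T: "simple_right_module R T" "y \<in> carrier T" "residual R T {\<zero>\<^bsub>T\<^esub>} y \<in> right_translates R {N}"
  shows "rmod_iso R S T"
proof -
  interpret S: right_module R S using S by (simp add: simple_right_module_def)
  interpret T: right_module R T using T by (simp add: simple_right_module_def)
  interpret RR: right_module R "right_regular_module R" by (rule S.R.right_regular_right_module)
  let ?res = "residual R (right_regular_module R)"
  obtain r where r: "r \<in> carrier R" "r \<notin> N" "residual R S {\<zero>\<^bsub>S\<^esub>} x = ?res N r"
    using S(3) by (auto simp: right_translates_def)
  obtain s where s: "s \<in> carrier R" "s \<notin> N" "residual R T {\<zero>\<^bsub>T\<^esub>} y = ?res N s"
    using T(3) by (auto simp: right_translates_def)
  obtain a u where au: "a \<in> N" "u \<in> carrier R" "s = a \<oplus>\<^bsub>R\<^esub> r \<otimes>\<^bsub>R\<^esub> u"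
    using S.R.maximal_right_ideal_cyclic(1)[OF N r(1,2) s(1)] by blast
  have Nsub: "submodule N R (right_regular_module R)"
    using N by (simp add: maximal_right_ideal_def S.R.right_ideal_iff_submodule)
  have "?res N s = ?res (?res N r) u"
    using RR.residual_coset[OF Nsub au(1), of "r \<otimes>\<^bsub>R\<^esub> u"] RR.residual_ract[of r u N] au r by simp
  also have "\<dots> = residual R S {\<zero>\<^bsub>S\<^esub>} (u \<odot>\<^bsub>S\<^esub> x)"
    using S.residual_ract[of x u "{\<zero>\<^bsub>S\<^esub>}"] S(2) au r by simp
  finally have eq: "residual R S {\<zero>\<^bsub>S\<^esub>} (u \<odot>\<^bsub>S\<^esub> x) = residual R T {\<zero>\<^bsub>T\<^esub>} y" using s by simp
  have "\<one>\<^bsub>R\<^esub> \<notin> ?res N s" using RR.one_in_residual[of s N] s by simp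
  then have "y \<noteq> \<zero>\<^bsub>T\<^esub>" "u \<odot>\<^bsub>S\<^esub> x \<noteq> \<zero>\<^bsub>S\<^esub>"
    using s(3) eq T.one_in_residual[OF T(2)] S.one_in_residual[OF S.ract_closed[OF au(2) S(2)]] by auto
  then show ?thesis using simple_modules_iso[OF S(1) _ _ T(1,2) _ eq] S.ract_closed au S(2) by simp
qed

lemma rmod_iso_trans:
  assumes "rmod_iso R M N" "rmod_iso R N P" shows "rmod_iso R M P"
proof -
  obtain f g where "f \<in> rmod_hom R M N" "bij_betw f (carrier M) (carrier N)"
    "g \<in> rmod_hom R N P" "bij_betw g (carrier N) (carrier P)"
    using assms by (auto simp: rmod_iso_def)
  then have "g \<circ> f \<in> rmod_hom R M P" "bij_betw (g \<circ> f) (carrier M) (carrier P)"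
    by (auto simp: rmod_hom_def Pi_iff intro: bij_betw_trans)
  then show ?thesis unfolding rmod_iso_def by blast
qed

text \<open>
  The pigeonhole principle, for labels \<open>k S\<close> that tell non-isomorphic simple modules apart.
\<close>
lemma finite_simple_right_module_classes:
  fixes R :: "('a, 'r) ring_scheme"
  assumes K: "finite K" "\<And>S :: ('a, 'a set) module. simple_right_module R S \<Longrightarrow> k S \<in> K"
    and iso: "\<And>(S :: ('a, 'a set) module) (T :: ('a, 'a set) module).
      simple_right_module R S \<Longrightarrow> simple_right_module R T \<Longrightarrow> k S = k T \<Longrightarrow> rmod_iso R S T"
  shows "finite (simple_right_module_classes R)"
proof -
  let ?A = "{M :: ('a, 'a set) module. simple_right_module R M}"
  let ?r = "{(M :: ('a, 'a set) module, N :: ('a, 'a set) module).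
    simple_right_module R M \<and> simple_right_module R N \<and> rmod_iso R M N}"
  have *: "?r `` {S} = ?r `` {T}"
    if "simple_right_module R S" "simple_right_module R T" "k S = k T" for S T :: "('a, 'a set) module"
  proof -
    have "rmod_iso R S T" "rmod_iso R T S" using that iso[of S T] iso[of T S] by simp_all
    then have "rmod_iso R S U = rmod_iso R T U" for U :: "('a, 'a set) module"
      using rmod_iso_trans by blast
    with that(1,2) show ?thesis by simp
  qed
  define g where "g c = ?r `` {SOME S. S \<in> ?A \<and> k S = c}" for c
  have "\<forall>S\<in>?A. ?r `` {S} = g (k S)"
  proof
    fix S assume S: "S \<in> ?A"
    let ?T = "SOME T. T \<in> ?A \<and> k T = k S"
    have "?T \<in> ?A \<and> k ?T = k S" by (rule someI[of _ S]) (use S in simp)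
    then have T: "simple_right_module R ?T" "k S = k ?T" by simp_all
    show "?r `` {S} = g (k S)" unfolding g_def by (rule *) (use S T in simp_all)
  qed
  then have "?A // ?r \<subseteq> g ` K" using K(2) by (auto simp: quotient_def)
  then show ?thesis unfolding simple_right_module_classes_def using K(1) finite_surj by blast
qed

text \<open>
  The elements \<open>y\<close> with \<open>a R y = 0\<close> form a two-sided ideal \<open>J\<close>, and so do the elements that annihilate \<open>J\<close>
  from the left. Their product is zero.
\<close>
lemma (in ring) prime_ringD:
  assumes "prime_ring R" "a \<in> carrier R" "b \<in> carrier R" "a \<noteq> \<zero>" "b \<noteq> \<zero>"
  shows "\<exists>u\<in>carrier R. a \<otimes> u \<otimes> b \<noteq> \<zero>"
proof (rule ccontr)
  assume "\<not> ?thesis"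
  then have ab: "a \<otimes> u \<otimes> b = \<zero>" if "u \<in> carrier R" for u using that by auto
  define J where "J = {y \<in> carrier R. \<forall>u\<in>carrier R. a \<otimes> u \<otimes> y = \<zero>}"
  define I where "I = {x \<in> carrier R. \<forall>y\<in>J. x \<otimes> y = \<zero>}"
  have idealI: "ideal H R"
    if H: "right_ideal H R" "\<And>x y. x \<in> carrier R \<Longrightarrow> y \<in> H \<Longrightarrow> x \<otimes> y \<in> H" for H
    using H ring_axioms unfolding right_ideal_def
    by (auto intro!: ideal.intro ideal_axioms.intro)
  have JR: "J \<subseteq> carrier R" by (auto simp: J_def)
  have J: "ideal J R"
  proof (rule idealI)
    show "right_ideal J R"
      unfolding right_ideal_iff
    proof (intro conjI ballI)
      show "x \<otimes> r \<in> J" if "x \<in> J" "r \<in> carrier R" for x r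
      proof -
        have "a \<otimes> u \<otimes> (x \<otimes> r) = a \<otimes> u \<otimes> x \<otimes> r" if "u \<in> carrier R" for u
          using that \<open>x \<in> J\<close> \<open>r \<in> _\<close> assms(2) by (simp add: J_def m_assoc)
        then show ?thesis using that by (simp add: J_def)
      qed
    qed (use JR assms(2) in \<open>auto simp: J_def r_distr\<close>)
    show "x \<otimes> y \<in> J" if "x \<in> carrier R" "y \<in> J" for x y
    proof -
      have "a \<otimes> u \<otimes> (x \<otimes> y) = a \<otimes> (u \<otimes> x) \<otimes> y" if "u \<in> carrier R" for u
        using that \<open>y \<in> J\<close> \<open>x \<in> _\<close> assms(2) by (simp add: J_def m_assoc)
      then show ?thesis using that by (simp add: J_def)
    qed
  qed
  have I: "ideal I R"
  proof (rule idealI)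
    have "x \<otimes> r \<otimes> y = x \<otimes> (r \<otimes> y)" "r \<otimes> y \<in> J" if "x \<in> I" "r \<in> carrier R" "y \<in> J" for x r y
      using that JR ideal.I_l_closed[OF J] by (auto simp: I_def m_assoc subset_iff)
    then show "right_ideal I R"
      unfolding right_ideal_iff using JR by (auto simp: I_def l_distr subset_iff)
    show "x \<otimes> y \<in> I" if "x \<in> carrier R" "y \<in> I" for x y
      using that JR by (auto simp: I_def m_assoc subset_iff)
  qed
  have "s = \<zero>" if "s \<in> ideal_prod R I J" for s
    using that by (induction rule: ideal_prod.induct) (auto simp: I_def)
  moreover have "\<zero> \<in> ideal_prod R I J"
    using ideal_prod.prod[of \<zero> I \<zero> J R] additive_subgroup.zero_closed[OF ideal.axioms(1)] I J by force
  ultimately have "ideal_prod R I J = {\<zero>}" by blast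
  then have "I = {\<zero>} \<or> J = {\<zero>}" using assms(1) I J by (simp add: prime_ring_def)
  moreover have "b \<in> J" using ab assms by (simp add: J_def)
  moreover have "a \<in> I"
  proof -
    have "a \<otimes> \<one> \<otimes> y = \<zero>" if "y \<in> J" for y using that by (simp add: J_def)
    then show ?thesis using assms(2) by (simp add: I_def)
  qed
  ultimately show False using assms by auto
qed

text \<open>
  If the annihilator of \<open>x\<close> meets a right ideal \<open>K \<noteq> 0\<close> trivially, then \<open>S\<close> is isomorphic to \<open>K\<close>; likewise
  \<open>T\<close> to some \<open>L\<close>. Primeness gives \<open>m \<in> K\<close>, \<open>n \<in> L\<close> and \<open>u\<close> with \<open>m u n \<noteq> 0\<close>, and left multiplication by \<open>m u\<close> is a
  nonzero map between the minimal right ideals \<open>L\<close> and \<open>K\<close>.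
\<close>
lemma simple_modules_iso_of_not_essential:
  assumes prime: "prime_ring R"
    and S: "simple_right_module R S" "x \<in> carrier S" "x \<noteq> \<zero>\<^bsub>S\<^esub>"
      "\<not> essential_right_ideal (residual R S {\<zero>\<^bsub>S\<^esub>} x) R"
    and T: "simple_right_module R T" "y \<in> carrier T" "y \<noteq> \<zero>\<^bsub>T\<^esub>"
      "\<not> essential_right_ideal (residual R T {\<zero>\<^bsub>T\<^esub>} y) R"
  shows "rmod_iso R S T"
proof -
  interpret S: right_module R S using S by (simp add: simple_right_module_def)
  interpret T: right_module R T using T by (simp add: simple_right_module_def)
  interpret RR: right_module R "right_regular_module R" by (rule S.R.right_regular_right_module)
  have "maximal_right_ideal (residual R S {\<zero>\<^bsub>S\<^esub>} x) R" "maximal_right_ideal (residual R T {\<zero>\<^bsub>T\<^esub>} y) R"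
    using simple_module_generator(2)[OF S(1-3)] simple_module_generator(2)[OF T(1-3)] .
  then obtain K L where
      K: "right_ideal K R" "K \<inter> residual R S {\<zero>\<^bsub>S\<^esub>} x = {\<zero>\<^bsub>R\<^esub>}" "K \<noteq> {\<zero>\<^bsub>R\<^esub>}" and
      L: "right_ideal L R" "L \<inter> residual R T {\<zero>\<^bsub>T\<^esub>} y = {\<zero>\<^bsub>R\<^esub>}" "L \<noteq> {\<zero>\<^bsub>R\<^esub>}"
    using S(4) T(4) unfolding essential_right_ideal_def maximal_right_ideal_def by metis
  obtain m n where m: "m \<in> K" "m \<noteq> \<zero>\<^bsub>R\<^esub>" and n: "n \<in> L" "n \<noteq> \<zero>\<^bsub>R\<^esub>"
    using K L unfolding S.R.right_ideal_iff by blast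
  have mn: "m \<in> carrier R" "n \<in> carrier R" using m n K L by (auto simp: S.R.right_ideal_iff)
  obtain u where u: "u \<in> carrier R" "m \<otimes>\<^bsub>R\<^esub> u \<otimes>\<^bsub>R\<^esub> n \<noteq> \<zero>\<^bsub>R\<^esub>"
    using S.R.prime_ringD[OF prime mn m(2) n(2)] by blast
  define p where "p = m \<otimes>\<^bsub>R\<^esub> u \<otimes>\<^bsub>R\<^esub> n"
  have p: "p \<in> K" "p \<noteq> \<zero>\<^bsub>R\<^esub>" "p \<in> carrier R"
    using u m mn K by (auto simp: p_def S.R.right_ideal_iff)
  have xp: "p \<odot>\<^bsub>S\<^esub> x \<noteq> \<zero>\<^bsub>S\<^esub>" "p \<odot>\<^bsub>S\<^esub> x \<in> carrier S"
    using p K(2) S(2) S.ract_closed by (auto simp: residual_def)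
  have yn: "n \<odot>\<^bsub>T\<^esub> y \<noteq> \<zero>\<^bsub>T\<^esub>" "n \<odot>\<^bsub>T\<^esub> y \<in> carrier T"
    using n mn L(2) T(2) T.ract_closed by (auto simp: residual_def)
  have "residual R T {\<zero>\<^bsub>T\<^esub>} (n \<odot>\<^bsub>T\<^esub> y) \<subseteq> residual R S {\<zero>\<^bsub>S\<^esub>} (p \<odot>\<^bsub>S\<^esub> x)"
    unfolding S.residual_ract_of_disjoint[OF S(2) K(1,2) p(1)] T.residual_ract_of_disjoint[OF T(2) L(1,2) n(1)] using mn u
    by (auto simp: residual_def p_def S.R.m_assoc)
  moreover have "maximal_right_ideal (residual R T {\<zero>\<^bsub>T\<^esub>} (n \<odot>\<^bsub>T\<^esub> y)) R"
    "maximal_right_ideal (residual R S {\<zero>\<^bsub>S\<^esub>} (p \<odot>\<^bsub>S\<^esub> x)) R"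
    using simple_module_generator(2)[OF S(1) xp(2,1)] simple_module_generator(2)[OF T(1) yn(2,1)] by simp_all
  ultimately have "residual R S {\<zero>\<^bsub>S\<^esub>} (p \<odot>\<^bsub>S\<^esub> x) = residual R T {\<zero>\<^bsub>T\<^esub>} (n \<odot>\<^bsub>T\<^esub> y)"
    unfolding maximal_right_ideal_def by blast
  then show ?thesis using simple_modules_iso[OF S(1) xp(2,1) T(1) yn(2,1)] by simp
qed

section \<open>Dual bases of projective right ideals\<close>

lemma rmod_hom_regular_mult:
  assumes "f \<in> rmod_hom R ((right_regular_module R)\<lparr>carrier := J\<rparr>) (right_regular_module R)"
    and "x \<in> J" "r \<in> carrier R"
  shows "f (x \<otimes>\<^bsub>R\<^esub> r) = f x \<otimes>\<^bsub>R\<^esub> r"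
  using assms by (simp add: rmod_hom_def right_regular_module_def)

text \<open>
  The free right module with basis \<open>J\<close>. Its elements are total functions, zero outside \<open>J\<close>, so that for a right
  ideal \<open>J\<close> it has the type at which \<open>right_projective\<close> states the lifting property.
\<close>
definition free_right_module :: "('a, 'r) ring_scheme \<Rightarrow> 'b set \<Rightarrow> ('a, 'b \<Rightarrow> 'a) module"
  where "free_right_module R J =
    \<lparr>carrier = {c. range c \<subseteq> carrier R \<and> finite {j. c j \<noteq> \<zero>\<^bsub>R\<^esub>} \<and> {j. c j \<noteq> \<zero>\<^bsub>R\<^esub>} \<subseteq> J},
     monoid.mult = undefined, one = undefined, ring.zero = (\<lambda>_. \<zero>\<^bsub>R\<^esub>),
     add = (\<lambda>c d j. c j \<oplus>\<^bsub>R\<^esub> d j), smult = (\<lambda>r c j. c j \<otimes>\<^bsub>R\<^esub> r)\<rparr>"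

context ring
begin

lemma free_right_module_simps [simp]:
  "c \<in> carrier (free_right_module R J) \<longleftrightarrow>
    range c \<subseteq> carrier R \<and> finite {j. c j \<noteq> \<zero>} \<and> {j. c j \<noteq> \<zero>} \<subseteq> J"
  "\<zero>\<^bsub>free_right_module R J\<^esub> = (\<lambda>_. \<zero>)"
  "c \<oplus>\<^bsub>free_right_module R J\<^esub> d = (\<lambda>j. c j \<oplus> d j)"
  "r \<odot>\<^bsub>free_right_module R J\<^esub> c = (\<lambda>j. c j \<otimes> r)"
  by (simp_all add: free_right_module_def)

lemma free_right_module_add_closed:
  assumes "c \<in> carrier (free_right_module R J)" "d \<in> carrier (free_right_module R J)"
  shows "(\<lambda>j. c j \<oplus> d j) \<in> carrier (free_right_module R J)"
proof -
  have "{j. c j \<oplus> d j \<noteq> \<zero>} \<subseteq> {j. c j \<noteq> \<zero>} \<union> {j. d j \<noteq> \<zero>}" by auto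
  moreover from this have "finite {j. c j \<oplus> d j \<noteq> \<zero>}" by (rule finite_subset) (use assms in auto)
  ultimately show ?thesis using assms by (auto simp: image_subset_iff)
qed

lemma free_right_module_scale_closed:
  assumes "c \<in> carrier (free_right_module R J)" "r \<in> carrier R"
  shows "(\<lambda>j. c j \<otimes> r) \<in> carrier (free_right_module R J)"
proof -
  have "{j. c j \<otimes> r \<noteq> \<zero>} \<subseteq> {j. c j \<noteq> \<zero>}" using assms by auto
  moreover from this have "finite {j. c j \<otimes> r \<noteq> \<zero>}" by (rule finite_subset) (use assms in auto)
  ultimately show ?thesis using assms by (auto simp: image_subset_iff)
qed

lemma free_right_module: "right_module R (free_right_module R J)"
proof -
  let ?F = "free_right_module R J"
  have neg: "(\<lambda>j. \<ominus> c j) \<in> carrier ?F" if "c \<in> carrier ?F" for c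
    using free_right_module_scale_closed[OF that, of "\<ominus> \<one>"] that by (simp add: r_minus image_subset_iff)
  have "abelian_group ?F"
  proof (rule abelian_groupI)
    show "\<exists>d\<in>carrier ?F. d \<oplus>\<^bsub>?F\<^esub> c = \<zero>\<^bsub>?F\<^esub>" if "c \<in> carrier ?F" for c
      by (rule bexI[OF _ neg[OF that]]) (use that in \<open>auto simp: l_neg image_subset_iff\<close>)
    show "c \<oplus>\<^bsub>?F\<^esub> d \<in> carrier ?F" if "c \<in> carrier ?F" "d \<in> carrier ?F" for c d
      using free_right_module_add_closed[OF that] unfolding free_right_module_simps(3) .
  qed (auto simp: image_subset_iff a_assoc a_comm a_lcomm)
  moreover have "right_module_axioms R ?F"
  proof
    show "r \<odot>\<^bsub>?F\<^esub> c \<in> carrier ?F" if "r \<in> carrier R" "c \<in> carrier ?F" for r c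
      using free_right_module_scale_closed[OF that(2,1)] unfolding free_right_module_simps(4) .
  qed (auto simp: image_subset_iff l_distr r_distr m_assoc)
  ultimately show ?thesis by (simp add: right_module_def ring_axioms)
qed

lemma right_ideal_finsum:
  assumes I: "right_ideal I R" and f: "finite A" "\<And>j. j \<in> A \<Longrightarrow> f j \<in> I"
  shows "(\<Oplus>j\<in>A. f j) \<in> I"
  using f
proof (induction A rule: finite_induct)
  case (insert a A)
  have "f ` insert a A \<subseteq> carrier R" using insert.prems I by (auto simp: right_ideal_iff)
  then have "(\<Oplus>j\<in>insert a A. f j) = f a \<oplus> (\<Oplus>j\<in>A. f j)"
    using insert.hyps by (intro finsum_insert) auto
  then show ?case using insert I by (auto simp: right_ideal_iff)
qed (use I in \<open>simp add: right_ideal_iff\<close>)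

definition (in -) linear_combination :: "('a, 'r) ring_scheme \<Rightarrow> ('a \<Rightarrow> 'a) \<Rightarrow> 'a"
  where "linear_combination R c = (\<Oplus>\<^bsub>R\<^esub>j\<in>{j. c j \<noteq> \<zero>\<^bsub>R\<^esub>}. j \<otimes>\<^bsub>R\<^esub> c j)"

lemma linear_combination_eq:
  assumes "finite A" "A \<subseteq> carrier R" "range c \<subseteq> carrier R" "{j. c j \<noteq> \<zero>} \<subseteq> A"
  shows "linear_combination R c = (\<Oplus>j\<in>A. j \<otimes> c j)"
  unfolding linear_combination_def using assms
  by (intro add.finprod_mono_neutral_cong_left) (auto simp: image_subset_iff)

lemma linear_combination_hom:
  assumes J: "right_ideal J R"
  shows "linear_combination R \<in> rmod_hom R (free_right_module R J) ((right_regular_module R)\<lparr>carrier := J\<rparr>)"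
    and "linear_combination R ` carrier (free_right_module R J) = J"
proof -
  let ?F = "free_right_module R J"
  have JR: "J \<subseteq> carrier R" using J by (simp add: right_ideal_iff)
  have supp: "linear_combination R c = (\<Oplus>j\<in>A. j \<otimes> c j)"
    if "finite A" "A \<subseteq> J" "c \<in> carrier ?F" "{j. c j \<noteq> \<zero>} \<subseteq> A" for A c
    using that JR by (intro linear_combination_eq) auto
  have closed: "linear_combination R c \<in> J" if "c \<in> carrier ?F" for c
    using that J unfolding linear_combination_def
    by (intro right_ideal_finsum) (auto simp: right_ideal_iff image_subset_iff)
  have add: "linear_combination R (\<lambda>j. c j \<oplus> d j) = linear_combination R c \<oplus> linear_combination R d"
    if c: "c \<in> carrier ?F" and d: "d \<in> carrier ?F" for c d
  proof -
    let ?A = "{j. c j \<noteq> \<zero>} \<union> {j. d j \<noteq> \<zero>}"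
    have A: "finite ?A" "?A \<subseteq> J" using c d by auto
    have "linear_combination R (\<lambda>j. c j \<oplus> d j) = (\<Oplus>j\<in>?A. j \<otimes> (c j \<oplus> d j))"
      using A free_right_module_add_closed[OF c d] by (intro supp) auto
    also have "\<dots> = (\<Oplus>j\<in>?A. j \<otimes> c j \<oplus> j \<otimes> d j)"
      using A JR c d by (intro finsum_cong') (auto simp: r_distr image_subset_iff subset_iff)
    also have "\<dots> = (\<Oplus>j\<in>?A. j \<otimes> c j) \<oplus> (\<Oplus>j\<in>?A. j \<otimes> d j)"
      using A JR c d by (intro finsum_addf) (auto simp: image_subset_iff subset_iff)
    also have "(\<Oplus>j\<in>?A. j \<otimes> c j) = linear_combination R c" using A c by (intro supp[symmetric]) auto
    also have "(\<Oplus>j\<in>?A. j \<otimes> d j) = linear_combination R d" using A d by (intro supp[symmetric]) auto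
    finally show ?thesis .
  qed
  have scale: "linear_combination R (\<lambda>j. c j \<otimes> r) = linear_combination R c \<otimes> r"
    if c: "c \<in> carrier ?F" and r: "r \<in> carrier R" for c r
  proof -
    let ?A = "{j. c j \<noteq> \<zero>}"
    have A: "finite ?A" "?A \<subseteq> J" using c by auto
    have "linear_combination R (\<lambda>j. c j \<otimes> r) = (\<Oplus>j\<in>?A. j \<otimes> (c j \<otimes> r))"
      using A free_right_module_scale_closed[OF c r] r by (intro supp) auto
    also have "\<dots> = (\<Oplus>j\<in>?A. j \<otimes> c j \<otimes> r)"
      using A JR c r by (intro finsum_cong') (auto simp: m_assoc image_subset_iff subset_iff)
    also have "\<dots> = (\<Oplus>j\<in>?A. j \<otimes> c j) \<otimes> r"
      using A JR c r by (intro finsum_ldistr[symmetric]) (auto simp: image_subset_iff subset_iff)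
    finally show ?thesis by (simp add: linear_combination_def)
  qed
  show "linear_combination R \<in> rmod_hom R ?F ((right_regular_module R)\<lparr>carrier := J\<rparr>)"
    unfolding rmod_hom_def using closed add scale
    by (simp add: Pi_iff right_regular_module_def del: free_right_module_simps(1))
  have "x \<in> linear_combination R ` carrier ?F" if x: "x \<in> J" for x
  proof -
    let ?c = "\<lambda>j. if j = x then \<one> else \<zero>"
    have "{j. ?c j \<noteq> \<zero>} \<subseteq> {x}" by auto
    moreover from this have "finite {j. ?c j \<noteq> \<zero>}" by (rule finite_subset) simp
    ultimately have c: "?c \<in> carrier ?F" using x by auto
    have "linear_combination R ?c = (\<Oplus>j\<in>{x}. j \<otimes> ?c j)"
      using x c by (intro supp) auto
    also have "\<dots> = x" using x JR by (subst finsum_insert) auto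
    finally show ?thesis using c by (metis imageI)
  qed
  then show "linear_combination R ` carrier ?F = J" using closed by blast
qed

text \<open>
  Lift the identity of \<open>J\<close> along the evaluation map from the free module on the set \<open>J\<close>; the coordinate
  functions of the lift are the \<open>g j\<close>. The set \<open>K\<close> depends on \<open>x\<close>, as \<open>J\<close> itself is used as a generating set.
\<close>
lemma dual_basis:
  assumes J: "right_ideal J R" and proj: "right_projective R ((right_regular_module R)\<lparr>carrier := J\<rparr>)"
  shows "\<exists>g. (\<forall>j. g j \<in> rmod_hom R ((right_regular_module R)\<lparr>carrier := J\<rparr>) (right_regular_module R)) \<and>
    (\<forall>x\<in>J. \<exists>K. finite K \<and> K \<subseteq> J \<and> x = (\<Oplus>j\<in>K. j \<otimes> g j x))"
proof -
  let ?F = "free_right_module R J" and ?P = "(right_regular_module R)\<lparr>carrier := J\<rparr>"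
  have P: "right_module R ?P" using proj by (simp add: right_projective_def)
  have "id \<in> rmod_hom R ?P ?P" by (auto simp: rmod_hom_def)
  moreover have "linear_combination R ` carrier ?F = carrier ?P"
    using linear_combination_hom(2)[OF J] by simp
  ultimately obtain h where h: "h \<in> rmod_hom R ?P ?F" "\<forall>x\<in>carrier ?P. linear_combination R (h x) = id x"
    using proj P free_right_module linear_combination_hom(1)[OF J] unfolding right_projective_def by blast
  have hF: "h x \<in> carrier ?F" if "x \<in> J" for x
    using h(1) that unfolding rmod_hom_def by (auto simp del: free_right_module_simps(1))
  show ?thesis
  proof (intro exI[of _ "\<lambda>j x. h x j"] conjI allI ballI)
    show "(\<lambda>x. h x j) \<in> rmod_hom R ?P (right_regular_module R)" for j
      using h(1) hF unfolding rmod_hom_def by (auto simp: image_subset_iff right_regular_module_def)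
    show "\<exists>K. finite K \<and> K \<subseteq> J \<and> x = (\<Oplus>j\<in>K. j \<otimes> h x j)" if "x \<in> J" for x
      using h(2) hF[OF that] that by (intro exI[of _ "{j. h x j \<noteq> \<zero>}"]) (auto simp: linear_combination_def)
  qed
qed

end

section \<open>Essential right ideals contain regular elements\<close>

lemma right_noetherian_maximal:
  assumes "right_noetherian R" "\<A> \<noteq> {}" "\<And>I. I \<in> \<A> \<Longrightarrow> right_ideal I R"
  shows "\<exists>I\<in>\<A>. \<forall>J\<in>\<A>. I \<subseteq> J \<longrightarrow> J = I"
proof (rule ccontr)
  assume neg: "\<not> ?thesis"
  have "\<exists>f. \<forall>n. f n \<in> \<A> \<and> f n \<subset> f (Suc n)"
  proof (rule dependent_nat_choice)
    show "\<exists>I. I \<in> \<A>" using assms(2) by blast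
    show "\<exists>J. J \<in> \<A> \<and> I \<subset> J" if "I \<in> \<A>" for I and n :: nat using neg that by blast
  qed
  then obtain f where f: "\<And>n. f n \<in> \<A>" "\<And>n. f n \<subset> f (Suc n)" by blast
  then have "\<exists>k. \<forall>n\<ge>k. f n = f k"
    using assms(1,3) unfolding right_noetherian_def by (meson psubset_imp_subset)
  then obtain k where "f (Suc k) = f k" by (metis le_Suc_eq order_refl)
  then show False using f(2)[of k] by simp
qed

lemma (in ring) ring_opposite: "ring (opposite_ring R)"
proof -
  have "abelian_group (opposite_ring R)"
    by (rule abelian_groupI) (auto simp: opposite_ring_def a_ac intro: l_neg)
  moreover have "Group.monoid (opposite_ring R)"
    by (rule monoidI) (auto simp: opposite_ring_def m_assoc)
  ultimately show ?thesis
    by (rule ringI[rotated 0, simplified]) (auto simp: opposite_ring_def l_distr r_distr)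
qed

lemma (in ring) left_ideal_iff:
  "right_ideal L (opposite_ring R) \<longleftrightarrow> L \<subseteq> carrier R \<and> \<zero> \<in> L \<and>
     (\<forall>x\<in>L. \<forall>y\<in>L. x \<oplus> y \<in> L) \<and> (\<forall>x\<in>L. \<forall>r\<in>carrier R. r \<otimes> x \<in> L)"
  unfolding ring.right_ideal_iff[OF ring_opposite] by (simp add: opposite_ring_def)

lemma (in ring) right_ideal_image_mult:
  assumes "right_ideal I R" "c \<in> carrier R" shows "right_ideal ((\<otimes>) c ` I) R"
  unfolding right_ideal_iff
proof (intro conjI ballI)
  have I: "I \<subseteq> carrier R" "\<zero> \<in> I" using assms by (auto simp: right_ideal_iff)
  show "(\<otimes>) c ` I \<subseteq> carrier R" using I assms(2) by auto
  show "\<zero> \<in> (\<otimes>) c ` I" using I assms(2) by (intro image_eqI[of _ _ \<zero>]) auto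
  show "x \<oplus> y \<in> (\<otimes>) c ` I" if xy: "x \<in> (\<otimes>) c ` I" "y \<in> (\<otimes>) c ` I" for x y
  proof -
    obtain i j where "i \<in> I" "j \<in> I" "x = c \<otimes> i" "y = c \<otimes> j" using xy by blast
    moreover from this I assms(2) have "x \<oplus> y = c \<otimes> (i \<oplus> j)" by (simp add: r_distr subset_iff)
    ultimately show ?thesis using assms(1) by (auto simp: right_ideal_iff)
  qed
  show "x \<otimes> r \<in> (\<otimes>) c ` I" if x: "x \<in> (\<otimes>) c ` I" "r \<in> carrier R" for x r
  proof -
    obtain i where "i \<in> I" "x = c \<otimes> i" using x by blast
    moreover from this I assms(2) x have "x \<otimes> r = c \<otimes> (i \<otimes> r)" by (simp add: m_assoc subset_iff)
    ultimately show ?thesis using assms(1) x by (auto simp: right_ideal_iff)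
  qed
qed

lemma (in ring) right_ideal_carrier: "right_ideal (carrier R) R"
  by (simp add: right_ideal_iff)

definition right_annihilator :: "('a, 'r) ring_scheme \<Rightarrow> 'a \<Rightarrow> 'a set"
  where "right_annihilator R c = {r \<in> carrier R. c \<otimes>\<^bsub>R\<^esub> r = \<zero>\<^bsub>R\<^esub>}"

lemma (in ring) right_ideal_annihilator:
  "c \<in> carrier R \<Longrightarrow> right_ideal (right_annihilator R c) R"
  by (auto simp: right_ideal_iff right_annihilator_def r_distr simp flip: m_assoc)

lemma (in ring) essential_nonzero:
  assumes "essential_right_ideal I R" "right_ideal K R" "k \<in> K" "k \<noteq> \<zero>"
  shows "\<exists>x\<in>K \<inter> I. x \<noteq> \<zero>"
proof (rule ccontr)
  assume "\<not> ?thesis"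
  moreover have "\<zero> \<in> K \<inter> I"
    using assms by (auto simp: essential_right_ideal_def right_ideal_iff)
  ultimately have "K \<inter> I = {\<zero>}" by blast
  then have "K = {\<zero>}" using assms(1,2) by (simp add: essential_right_ideal_def)
  with assms(3,4) show False by simp
qed

locale hnp = ring +
  assumes hnp: "hnp_ring R"
begin

lemma right_noetherian: "right_noetherian R" and left_noetherian: "right_noetherian (opposite_ring R)"
  and prime: "prime_ring R"
  using hnp by (simp_all add: hnp_ring_def)

lemma right_ideal_projective:
  "right_ideal I R \<Longrightarrow> right_projective R ((right_regular_module R)\<lparr>carrier := I\<rparr>)"
  using hnp by (simp add: hnp_ring_def right_hereditary_def)

text \<open>
  The right ideal \<open>c R\<close> is projective, so \<open>R \<rightarrow> c R\<close> splits and the right annihilator of \<open>c\<close> is a direct summand;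
  \<open>u\<close> is the projection onto a complement. From a dual basis \<open>c = \<Sum> (c \<rho>\<^sub>j) g\<^sub>j(c)\<close> one reads off
  \<open>u = \<Sum> \<rho>\<^sub>j g\<^sub>j(c)\<close>, which kills every \<open>r\<close> with \<open>c r = 0\<close> because \<open>g\<^sub>j(c) r = g\<^sub>j(c r)\<close>.
\<close>
lemma annihilator_splits:
  assumes c: "c \<in> carrier R"
  obtains u where "u \<in> carrier R" "c \<otimes> u = c" "\<And>r. r \<in> carrier R \<Longrightarrow> c \<otimes> r = \<zero> \<Longrightarrow> u \<otimes> r = \<zero>"
proof -
  let ?J = "(\<otimes>) c ` carrier R"
  let ?P = "(right_regular_module R)\<lparr>carrier := ?J\<rparr>"
  have J: "right_ideal ?J R" by (rule right_ideal_image_mult[OF right_ideal_carrier c])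
  have cJ: "c \<in> ?J" "\<zero> \<in> ?J"
    using c image_eqI[of c "(\<otimes>) c" \<one>] image_eqI[of \<zero> "(\<otimes>) c" \<zero>] by simp_all
  obtain g where g: "\<forall>j. g j \<in> rmod_hom R ?P (right_regular_module R)"
    "\<forall>x\<in>?J. \<exists>K. finite K \<and> K \<subseteq> ?J \<and> x = (\<Oplus>j\<in>K. j \<otimes> g j x)"
    using dual_basis[OF J right_ideal_projective[OF J]] by blast
  have gR: "g j x \<in> carrier R" if "x \<in> ?J" for j x using g(1)[rule_format, of j] that by (auto simp: rmod_hom_def)
  have gmult: "g j (x \<otimes> r) = g j x \<otimes> r" if "x \<in> ?J" "r \<in> carrier R" for j x r
    using g(1) that by (intro rmod_hom_regular_mult[where f = "g j"]) blast+
  obtain K where K: "finite K" "K \<subseteq> ?J" "c = (\<Oplus>j\<in>K. j \<otimes> g j c)" using g(2) cJ(1) by blast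
  have "\<forall>j\<in>K. \<exists>r. r \<in> carrier R \<and> j = c \<otimes> r" using K(2) by blast
  then obtain \<rho> where \<rho>: "\<And>j. j \<in> K \<Longrightarrow> \<rho> j \<in> carrier R" "\<And>j. j \<in> K \<Longrightarrow> j = c \<otimes> \<rho> j" by metis
  define u where "u = (\<Oplus>j\<in>K. \<rho> j \<otimes> g j c)"
  have terms: "(\<lambda>j. \<rho> j \<otimes> g j c) \<in> K \<rightarrow> carrier R" using \<rho>(1) gR[OF cJ(1)] by auto
  show thesis
  proof
    show "u \<in> carrier R" unfolding u_def using terms by (rule finsum_closed)
    have "c \<otimes> u = (\<Oplus>j\<in>K. c \<otimes> (\<rho> j \<otimes> g j c))" unfolding u_def using K(1) c terms by (intro finsum_rdistr)
    also have "\<dots> = (\<Oplus>j\<in>K. j \<otimes> g j c)"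
    proof (intro finsum_cong')
      show "(\<lambda>j. j \<otimes> g j c) \<in> K \<rightarrow> carrier R" using K(2) c gR[OF cJ(1)] by auto
      show "c \<otimes> (\<rho> j \<otimes> g j c) = j \<otimes> g j c" if "j \<in> K" for j
        using \<rho>[OF that] c gR[OF cJ(1), of j] by (metis m_assoc)
    qed simp
    finally show "c \<otimes> u = c" using K(3) by simp
    show "u \<otimes> r = \<zero>" if r: "r \<in> carrier R" "c \<otimes> r = \<zero>" for r
    proof -
      have "g j c \<otimes> r = \<zero>" for j
      proof -
        have "g j c \<otimes> r = g j (\<zero> \<otimes> \<zero>)" using gmult[OF cJ(1) r(1)] r(2) by simp
        also have "\<dots> = g j \<zero> \<otimes> \<zero>" using gmult[OF cJ(2), of \<zero>] by simp
        finally show ?thesis using gR[OF cJ(2)] by simp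
      qed
      then have "\<rho> j \<otimes> g j c \<otimes> r = \<zero>" if "j \<in> K" for j
        using \<rho>(1)[OF that] gR[OF cJ(1)] r(1) by (simp add: m_assoc)
      then have "(\<Oplus>j\<in>K. \<rho> j \<otimes> g j c \<otimes> r) = (\<Oplus>j\<in>K. \<zero>)" by (intro finsum_cong') auto
      then show ?thesis unfolding u_def using finsum_ldistr[OF K(1) r(1) terms] by simp
    qed
  qed
qed

text \<open>
  A right ideal \<open>K \<noteq> 0\<close> meets \<open>c R\<close>, and the preimage \<open>L\<close> of \<open>K\<close> under \<open>c\<close> has the part \<open>u L\<close> on which \<open>c\<close> is injective.
  That part is nonzero, so it meets \<open>A\<close>, and applying \<open>c\<close> gives a nonzero element of \<open>K \<inter> c A\<close>.
\<close>
lemma essential_image_mult: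
  assumes c: "c \<in> carrier R" "essential_right_ideal ((\<otimes>) c ` carrier R) R"
    and A: "essential_right_ideal A R"
  shows "essential_right_ideal ((\<otimes>) c ` A) R"
proof -
  have AR: "right_ideal A R" using A by (simp add: essential_right_ideal_def)
  obtain u where u: "u \<in> carrier R" "c \<otimes> u = c" "\<And>r. r \<in> carrier R \<Longrightarrow> c \<otimes> r = \<zero> \<Longrightarrow> u \<otimes> r = \<zero>"
    using annihilator_splits[OF c(1)] by blast
  have "K = {\<zero>}" if K: "right_ideal K R" "K \<inter> (\<otimes>) c ` A = {\<zero>}" for K
  proof (rule ccontr)
    assume "K \<noteq> {\<zero>}"
    then obtain k0 where "k0 \<in> K" "k0 \<noteq> \<zero>" using K(1) unfolding right_ideal_iff by blast
    then obtain k where k: "k \<in> carrier R" "c \<otimes> k \<in> K" "c \<otimes> k \<noteq> \<zero>"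
      using essential_nonzero[OF c(2) K(1)] by blast
    define L where "L = {r \<in> carrier R. c \<otimes> r \<in> K}"
    have L: "right_ideal L R"
      using K(1) c(1) by (auto simp: L_def right_ideal_iff r_distr simp flip: m_assoc)
    have "u \<otimes> k \<noteq> \<zero>"
      using u k c by (metis m_assoc r_null)
    moreover have "u \<otimes> k \<in> (\<otimes>) u ` L" using k by (auto simp: L_def)
    ultimately obtain l where l: "l \<in> L" "u \<otimes> l \<in> A" "u \<otimes> l \<noteq> \<zero>"
      using essential_nonzero[OF A right_ideal_image_mult[OF L u(1)]] by blast
    have lR: "l \<in> carrier R" "c \<otimes> l \<in> K" using l by (auto simp: L_def)
    have "c \<otimes> l = c \<otimes> (u \<otimes> l)" using u(1,2) lR c by (simp flip: m_assoc)
    then have "c \<otimes> l \<in> K \<inter> (\<otimes>) c ` A" using lR l(2) by auto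
    then have "c \<otimes> l = \<zero>" using K(2) by blast
    then show False using u(3)[OF lR(1)] l(3) by simp
  qed
  then show ?thesis
    using right_ideal_image_mult[OF AR c(1)] by (simp add: essential_right_ideal_def)
qed

text \<open>
  Fitting's argument: the right annihilators of the powers of \<open>c\<close> become stationary at some \<open>c\<^sup>n\<close>, and then the
  annihilator of \<open>c\<close> meets \<open>c\<^sup>n R\<close> trivially. But \<open>c\<^sup>n R\<close> is essential.
\<close>
lemma annihilator_zero_if_essential:
  assumes c: "c \<in> carrier R" "essential_right_ideal ((\<otimes>) c ` carrier R) R"
  shows "right_annihilator R c = {\<zero>}"
proof -
  have pow: "c [^] Suc n \<otimes> r = c \<otimes> (c [^] n \<otimes> r)" if "r \<in> carrier R" for r and n :: nat
    unfolding nat_pow_Suc2[OF c(1)] using that c by (simp add: m_assoc)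
  have ess: "essential_right_ideal ((\<otimes>) (c [^] n) ` carrier R) R" for n :: nat
  proof (induction n)
    case 0
    have "(\<otimes>) \<one> ` carrier R = carrier R" by (simp cong: image_cong)
    moreover have "K = {\<zero>}" if "right_ideal K R" "K \<inter> carrier R = {\<zero>}" for K
      using that by (simp add: right_ideal_iff Int_absorb2)
    ultimately show ?case
      by (simp add: essential_right_ideal_def right_ideal_carrier)
  next
    case (Suc n)
    have "(\<otimes>) (c [^] Suc n) ` carrier R = (\<otimes>) c ` (\<otimes>) (c [^] n) ` carrier R"
      unfolding image_image
      by (intro image_cong) (use pow in \<open>auto simp del: nat_pow_Suc\<close>)
    then show ?case using essential_image_mult[OF c Suc] by simp
  qed
  have "\<exists>I\<in>range (\<lambda>n::nat. right_annihilator R (c [^] n)).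
      \<forall>J\<in>range (\<lambda>n::nat. right_annihilator R (c [^] n)). I \<subseteq> J \<longrightarrow> J = I"
    using right_noetherian c right_ideal_annihilator by (intro right_noetherian_maximal) auto
  then obtain n :: nat where n: "\<And>m::nat. right_annihilator R (c [^] n) \<subseteq> right_annihilator R (c [^] m)
      \<Longrightarrow> right_annihilator R (c [^] m) = right_annihilator R (c [^] n)"
    by auto
  have eq: "right_annihilator R (c [^] Suc n) = right_annihilator R (c [^] n)"
    by (rule n) (use c pow in \<open>auto simp: right_annihilator_def\<close>)
  have "right_annihilator R c \<inter> (\<otimes>) (c [^] n) ` carrier R \<subseteq> {\<zero>}"
  proof
    fix x assume "x \<in> right_annihilator R c \<inter> (\<otimes>) (c [^] n) ` carrier R"
    then obtain y where y: "y \<in> carrier R" "x = c [^] n \<otimes> y" "c \<otimes> x = \<zero>"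
      by (auto simp: right_annihilator_def)
    then have "y \<in> right_annihilator R (c [^] Suc n)" using pow by (simp add: right_annihilator_def)
    then show "x \<in> {\<zero>}" using y unfolding eq by (simp add: right_annihilator_def)
  qed
  then have "x = \<zero>" if "x \<in> right_annihilator R c" for x
    using essential_nonzero[OF ess right_ideal_annihilator[OF c(1)] that] by blast
  moreover have "\<zero> \<in> right_annihilator R c" using c(1) by (simp add: right_annihilator_def)
  ultimately show ?thesis by blast
qed

text \<open>
  If \<open>K \<inter> c R = 0\<close> and \<open>c\<close> is left cancellable then the sum \<open>K + c K + c\<^sup>2 K + \<dots>\<close> is direct. Its partial sums
  \<open>I n\<close> become stationary, and cancelling \<open>c\<close> moves the equality \<open>I (Suc n) = I n\<close> down to \<open>c K \<subseteq> K\<close>.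
\<close>
lemma essential_if_annihilator_zero:
  assumes c: "c \<in> carrier R" and ann: "right_annihilator R c = {\<zero>}"
  shows "essential_right_ideal ((\<otimes>) c ` carrier R) R"
proof -
  have cancel: "x = \<zero>" if "x \<in> carrier R" "c \<otimes> x = \<zero>" for x
    using that ann by (auto simp: right_annihilator_def)
  have "K = {\<zero>}" if K: "right_ideal K R" "K \<inter> (\<otimes>) c ` carrier R = {\<zero>}" for K
  proof -
    have KR: "K \<subseteq> carrier R" "\<zero> \<in> K" using K by (auto simp: right_ideal_iff)
    define T where "T I = {k \<oplus> c \<otimes> i | k i. k \<in> K \<and> i \<in> I}" for I
    have T: "right_ideal (T I) R" if I: "right_ideal I R" for I
    proof -
      interpret M: right_module R "right_regular_module R" by (rule right_regular_right_module)
      have "T I = K <+>\<^bsub>right_regular_module R\<^esub> (\<otimes>) c ` I" by (auto simp: T_def set_add_def')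
      then show ?thesis
        using M.submodule_sum right_ideal_image_mult[OF I c] K(1) by (simp add: right_ideal_iff_submodule)
    qed
    define I where "I n = (T ^^ n) K" for n
    have I0: "I 0 = K" and IS: "I (Suc n) = T (I n)" for n by (simp_all add: I_def)
    have I: "right_ideal (I n) R" for n by (induction n) (auto simp: I0 IS K T)
    have "\<exists>A\<in>range I. \<forall>B\<in>range I. A \<subseteq> B \<longrightarrow> B = A"
      using right_noetherian I by (intro right_noetherian_maximal) auto
    then obtain n where n: "\<And>m. I n \<subseteq> I m \<Longrightarrow> I m = I n" by auto
    have mono: "I n \<subseteq> I (Suc n)" for n
    proof (induction n)
      case 0
      have "k = k \<oplus> c \<otimes> \<zero>" if "k \<in> K" for k using that KR c by auto
      then show ?case unfolding I0 IS T_def using KR by blast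
    qed (auto simp: IS T_def)
    have "I (Suc n) \<subseteq> I n \<Longrightarrow> K = {\<zero>}" for n
    proof (induction n)
      case 0
      have "k = \<zero>" if k: "k \<in> K" for k
      proof -
        have kR: "k \<in> carrier R" using k KR by blast
        have "\<zero> \<oplus> c \<otimes> k \<in> I (Suc 0)" unfolding IS I0 T_def using k KR by blast
        then have "\<zero> \<oplus> c \<otimes> k \<in> K" using 0 unfolding I0 by blast
        moreover have "\<zero> \<oplus> c \<otimes> k = c \<otimes> k" using kR c by simp
        ultimately have "c \<otimes> k \<in> K \<inter> (\<otimes>) c ` carrier R" using kR by simp
        then have "c \<otimes> k = \<zero>" unfolding K(2) by simp
        then show ?thesis by (rule cancel[OF kR])
      qed
      then show ?case using KR(2) by blast
    next
      case (Suc n)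
      have "i \<in> I n" if i: "i \<in> I (Suc n)" for i
      proof -
        have iR: "i \<in> carrier R" using i I[of "Suc n"] by (auto simp: right_ideal_iff)
        have "\<zero> \<oplus> c \<otimes> i \<in> I (Suc (Suc n))" unfolding IS[of "Suc n"] T_def using i KR by blast
        then have "c \<otimes> i \<in> T (I n)" using Suc.prems iR c by (auto simp: IS)
        then obtain k i' where k: "k \<in> K" "i' \<in> I n" "c \<otimes> i = k \<oplus> c \<otimes> i'" by (auto simp: T_def)
        have R: "k \<in> carrier R" "i' \<in> carrier R" using k KR I[of n] by (auto simp: right_ideal_iff)
        have "c \<otimes> (i \<ominus> i') = c \<otimes> i \<ominus> c \<otimes> i'" using R iR c by (simp add: minus_eq r_distr r_minus)
        also have "\<dots> = k" using k(3) R c by (simp add: minus_eq a_assoc r_neg)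
        finally have *: "c \<otimes> (i \<ominus> i') = k" .
        then have "k \<in> K \<inter> (\<otimes>) c ` carrier R" using k(1) R iR by force
        then have "i \<ominus> i' = \<zero>" using K(2) * cancel[of "i \<ominus> i'"] R iR by auto
        then show ?thesis using k(2) R iR by (simp add: diff_eq_zero_iff)
      qed
      then show ?case using Suc.IH by blast
    qed
    then show ?thesis using n[OF mono] by blast
  qed
  then show ?thesis
    using right_ideal_image_mult[OF right_ideal_carrier c] by (simp add: essential_right_ideal_def)
qed

text \<open>
  If \<open>x c = 0\<close> then \<open>x\<close> kills the essential right ideal \<open>c R\<close>, but \<open>x\<close> acts
  injectively on a complement \<open>u R\<close> of its own right annihilator.
\<close>
lemma annihilator_zero_imp_regular:
  assumes c: "c \<in> carrier R" and ann: "right_annihilator R c = {\<zero>}"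
  shows "c \<in> regular_elements R"
proof -
  have "x = \<zero>" if x: "x \<in> carrier R" "x \<otimes> c = \<zero>" for x
  proof -
    obtain u where u: "u \<in> carrier R" "x \<otimes> u = x" "\<And>r. r \<in> carrier R \<Longrightarrow> x \<otimes> r = \<zero> \<Longrightarrow> u \<otimes> r = \<zero>"
      using annihilator_splits[OF x(1)] by blast
    have "z = \<zero>" if z: "z \<in> (\<otimes>) u ` carrier R \<inter> (\<otimes>) c ` carrier R" for z
    proof -
      obtain r s where rs: "r \<in> carrier R" "s \<in> carrier R" "z = u \<otimes> r" "z = c \<otimes> s" using z by blast
      have "x \<otimes> r = x \<otimes> z" using rs u x by (simp flip: m_assoc)
      also have "\<dots> = \<zero>" using rs(2,4) x c by (simp flip: m_assoc)
      finally show ?thesis using u(3) rs by simp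
    qed
    then have "u = \<zero>"
      using essential_nonzero[OF essential_if_annihilator_zero[OF c ann]
          right_ideal_image_mult[OF right_ideal_carrier u(1)], of u] u(1)
      by (metis image_eqI one_closed r_one)
    then show ?thesis using u x by simp
  qed
  then show ?thesis using c ann by (auto simp: regular_elements_def right_annihilator_def)
qed

text \<open>
  Choose \<open>c \<in> I\<close> with minimal right annihilator; minimality is expressed by maximality of the left ideal
  \<open>L c\<close> of elements that kill this annihilator. If the annihilator is nonzero then \<open>c R\<close> is not
  essential, and primeness yields \<open>d \<in> I\<close> with \<open>d R \<inter> c R = 0\<close> that does not kill the annihilator of \<open>c\<close>. The
  annihilator of \<open>c + d\<close> is then strictly smaller.
\<close>
lemma essential_contains_regular:
  assumes I: "essential_right_ideal I R"
  shows "\<exists>c\<in>I. c \<in> regular_elements R"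
proof -
  have IR: "right_ideal I R" "I \<subseteq> carrier R" "I \<noteq> {}"
    using I by (auto simp: essential_right_ideal_def right_ideal_iff)
  define L where "L c = {x \<in> carrier R. \<forall>r\<in>right_annihilator R c. x \<otimes> r = \<zero>}" for c
  have "right_ideal (L c) (opposite_ring R)" for c
    unfolding left_ideal_iff L_def right_annihilator_def by (auto simp: l_distr m_assoc)
  then have "\<exists>A\<in>L ` I. \<forall>B\<in>L ` I. A \<subseteq> B \<longrightarrow> B = A"
    using left_noetherian IR(3) by (intro right_noetherian_maximal) auto
  then obtain c where c: "c \<in> I" "\<And>d. d \<in> I \<Longrightarrow> L c \<subseteq> L d \<Longrightarrow> L d = L c" by auto
  have cR: "c \<in> carrier R" using c IR by auto
  have "right_annihilator R c = {\<zero>}"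
  proof (rule ccontr)
    assume ann: "right_annihilator R c \<noteq> {\<zero>}"
    then obtain r where r: "r \<in> carrier R" "c \<otimes> r = \<zero>" "r \<noteq> \<zero>"
      using cR by (auto simp: right_annihilator_def)
    obtain K where K: "right_ideal K R" "K \<inter> (\<otimes>) c ` carrier R = {\<zero>}" "K \<noteq> {\<zero>}"
      using annihilator_zero_if_essential[OF cR] ann right_ideal_image_mult[OF right_ideal_carrier cR]
      unfolding essential_right_ideal_def by blast
    obtain k0 where k0: "k0 \<in> K" "k0 \<noteq> \<zero>" using K by (auto simp: right_ideal_iff)
    obtain k where k: "k \<in> K" "k \<in> I" "k \<noteq> \<zero>" using essential_nonzero[OF I K(1) k0] by blast
    obtain u where u: "u \<in> carrier R" "k \<otimes> u \<otimes> r \<noteq> \<zero>"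
      using prime_ringD[OF prime _ r(1) k(3) r(3)] k(2) IR(2) by blast
    define d where "d = k \<otimes> u"
    have d: "d \<in> K" "d \<in> I" "d \<in> carrier R" "d \<otimes> r \<noteq> \<zero>"
      using k u IR K(1) by (auto simp: d_def right_ideal_iff)
    define e where "e = c \<oplus> d"
    have e: "e \<in> I" "e \<in> carrier R" using c(1) d IR by (auto simp: e_def right_ideal_iff)
    have "right_annihilator R e \<subseteq> right_annihilator R c"
    proof
      fix x assume "x \<in> right_annihilator R e"
      then have x: "x \<in> carrier R" "c \<otimes> x \<oplus> d \<otimes> x = \<zero>"
        using cR d by (auto simp: right_annihilator_def e_def l_distr)
      then have "d \<otimes> x = c \<otimes> (\<ominus> x)"
        using cR d by (simp add: r_minus) (metis a_comm m_closed minus_equality)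
      then have "d \<otimes> x \<in> (\<otimes>) c ` carrier R" using x(1) by simp
      moreover have "d \<otimes> x \<in> K" using d(1) x(1) K(1) by (simp add: right_ideal_iff)
      ultimately have "d \<otimes> x \<in> K \<inter> (\<otimes>) c ` carrier R" by blast
      then have "d \<otimes> x = \<zero>" using K(2) by blast
      then show "x \<in> right_annihilator R c" using x cR by (simp add: right_annihilator_def)
    qed
    then have "L c \<subseteq> L e" by (auto simp: L_def)
    then have "L e = L c" using c(2) e by blast
    moreover have "e \<in> L e" using e by (simp add: L_def right_annihilator_def)
    ultimately have "e \<otimes> r = \<zero>" using r by (auto simp: L_def right_annihilator_def)
    then show False using r cR d by (simp add: e_def l_distr)
  qed
  then show ?thesis using annihilator_zero_imp_regular[OF cR] c(1) by blast
qed

end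

section \<open>Finite length modulo a regular element\<close>

lemma (in monoid) Units_right_cancel:
  assumes "u \<in> Units G" "x \<in> carrier G" "y \<in> carrier G" "x \<otimes> u = y \<otimes> u" shows "x = y"
proof -
  have "z \<otimes> u \<otimes> inv u = z" if "z \<in> carrier G" for z
    using that assms(1) by (simp add: m_assoc Units_closed)
  then show ?thesis using assms(2-4) by metis
qed

definition fraction_module ::
  "('b, 'q) ring_scheme \<Rightarrow> ('a \<Rightarrow> 'b) \<Rightarrow> ('a, 'b) module"
  where "fraction_module Q \<phi> = \<lparr>carrier = carrier Q, monoid.mult = undefined, one = undefined,
    ring.zero = \<zero>\<^bsub>Q\<^esub>, add = (\<oplus>\<^bsub>Q\<^esub>), smult = (\<lambda>r q. q \<otimes>\<^bsub>Q\<^esub> \<phi> r)\<rparr>"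

lemma fraction_module_simps [simp]:
  "carrier (fraction_module Q \<phi>) = carrier Q"
  "\<zero>\<^bsub>fraction_module Q \<phi>\<^esub> = \<zero>\<^bsub>Q\<^esub>"
  "x \<oplus>\<^bsub>fraction_module Q \<phi>\<^esub> y = x \<oplus>\<^bsub>Q\<^esub> y"
  "r \<odot>\<^bsub>fraction_module Q \<phi>\<^esub> q = q \<otimes>\<^bsub>Q\<^esub> \<phi> r"
  by (simp_all add: fraction_module_def)

locale hnp_quotient = hnp R for R :: "('a, 'r) ring_scheme" (structure) +
  fixes Q :: "('b, 'q) ring_scheme" and \<phi> :: "'a \<Rightarrow> 'b"
  assumes goldie: "goldie_quotient_ring R Q \<phi>"
begin

sublocale Q: ring Q
  using goldie by (simp add: goldie_quotient_ring_def)

sublocale \<phi>: ring_hom_ring R Q \<phi>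
  using goldie ring_axioms Q.ring_axioms by (intro ring_hom_ringI2) (simp_all add: goldie_quotient_ring_def)

lemma \<phi>_eq_iff: "x \<in> carrier R \<Longrightarrow> y \<in> carrier R \<Longrightarrow> \<phi> x = \<phi> y \<longleftrightarrow> x = y"
  using goldie by (auto simp: goldie_quotient_ring_def inj_on_def)

lemma regular_closed: "s \<in> regular_elements R \<Longrightarrow> s \<in> carrier R"
  by (simp add: regular_elements_def)

lemma regular_unit: "s \<in> regular_elements R \<Longrightarrow> \<phi> s \<in> Units Q"
  using goldie by (auto simp: goldie_quotient_ring_def)

lemma right_fraction:
  assumes "q \<in> carrier Q"
  obtains a s where "a \<in> carrier R" "s \<in> regular_elements R" "q \<otimes>\<^bsub>Q\<^esub> \<phi> s = \<phi> a"
proof -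
  obtain a s where as: "a \<in> carrier R" "s \<in> regular_elements R" "q = \<phi> a \<otimes>\<^bsub>Q\<^esub> inv\<^bsub>Q\<^esub> (\<phi> s)"
    using goldie assms unfolding goldie_quotient_ring_def by blast
  have "q \<otimes>\<^bsub>Q\<^esub> \<phi> s = \<phi> a"
    using as regular_unit[OF as(2)] regular_closed[OF as(2)] by (simp add: Q.m_assoc)
  with as that show thesis by blast
qed

lemma left_fraction:
  assumes "q \<in> carrier Q"
  obtains b t where "b \<in> carrier R" "t \<in> regular_elements R" "q = inv\<^bsub>Q\<^esub> (\<phi> t) \<otimes>\<^bsub>Q\<^esub> \<phi> b"
  using goldie assms that unfolding goldie_quotient_ring_def by blast

lemma ore_condition:
  assumes "x \<in> carrier R" "t \<in> regular_elements R"
  obtains b s where "b \<in> carrier R" "s \<in> regular_elements R" "x \<otimes> s = t \<otimes> b"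
proof -
  note t = regular_unit[OF assms(2)] regular_closed[OF assms(2)]
  obtain b s where bs: "b \<in> carrier R" "s \<in> regular_elements R"
    "inv\<^bsub>Q\<^esub> (\<phi> t) \<otimes>\<^bsub>Q\<^esub> \<phi> x \<otimes>\<^bsub>Q\<^esub> \<phi> s = \<phi> b"
    using right_fraction[of "inv\<^bsub>Q\<^esub> (\<phi> t) \<otimes>\<^bsub>Q\<^esub> \<phi> x"] assms(1) t by auto
  note s = regular_closed[OF bs(2)]
  have "\<phi> (t \<otimes> b) = \<phi> t \<otimes>\<^bsub>Q\<^esub> (inv\<^bsub>Q\<^esub> (\<phi> t) \<otimes>\<^bsub>Q\<^esub> \<phi> x \<otimes>\<^bsub>Q\<^esub> \<phi> s)"
    using t bs by simp
  also have "\<dots> = (\<phi> t \<otimes>\<^bsub>Q\<^esub> inv\<^bsub>Q\<^esub> (\<phi> t)) \<otimes>\<^bsub>Q\<^esub> (\<phi> x \<otimes>\<^bsub>Q\<^esub> \<phi> s)"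
    using t s assms(1) by (simp add: Q.m_assoc del: Q.Units_r_inv)
  also have "\<dots> = \<phi> (x \<otimes> s)" using t s assms(1) by simp
  finally have "x \<otimes> s = t \<otimes> b" using \<phi>_eq_iff[of "x \<otimes> s" "t \<otimes> b"] t s bs assms(1) by simp
  with bs that show thesis by blast
qed

text \<open>
  For \<open>t \<in> J\<close> the module \<open>J\<^sup>* = {q. q J \<subseteq> R}\<close> is contained in \<open>R t\<inverse>\<close>. It is represented by the numerators \<open>a\<close> of
  its elements \<open>a t\<inverse>\<close>, which form a left ideal of \<open>R\<close>.
\<close>
definition dual :: "'a \<Rightarrow> 'a set \<Rightarrow> 'a set"
  where "dual t J = {a \<in> carrier R. \<forall>x\<in>J. \<phi> a \<otimes>\<^bsub>Q\<^esub> inv\<^bsub>Q\<^esub> (\<phi> t) \<otimes>\<^bsub>Q\<^esub> \<phi> x \<in> \<phi> ` carrier R}"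

lemma dual_left_ideal:
  assumes t: "t \<in> regular_elements R" and J: "J \<subseteq> carrier R"
  shows "right_ideal (dual t J) (opposite_ring R)"
  unfolding left_ideal_iff
proof (intro conjI ballI)
  let ?i = "inv\<^bsub>Q\<^esub> (\<phi> t)"
  have i: "?i \<in> carrier Q" using regular_unit[OF t] by simp
  show "dual t J \<subseteq> carrier R" by (auto simp: dual_def)
  show "\<zero> \<in> dual t J" using i J by (auto simp: dual_def intro!: image_eqI[of _ _ \<zero>])
  show "a \<oplus> b \<in> dual t J" if ab: "a \<in> dual t J" "b \<in> dual t J" for a b
  proof -
    have "\<phi> (a \<oplus> b) \<otimes>\<^bsub>Q\<^esub> ?i \<otimes>\<^bsub>Q\<^esub> \<phi> x \<in> \<phi> ` carrier R" if x: "x \<in> J" for x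
    proof -
      obtain y z where "y \<in> carrier R" "z \<in> carrier R"
        "\<phi> a \<otimes>\<^bsub>Q\<^esub> ?i \<otimes>\<^bsub>Q\<^esub> \<phi> x = \<phi> y" "\<phi> b \<otimes>\<^bsub>Q\<^esub> ?i \<otimes>\<^bsub>Q\<^esub> \<phi> x = \<phi> z"
        using ab x unfolding dual_def by blast
      moreover from this have "\<phi> (a \<oplus> b) \<otimes>\<^bsub>Q\<^esub> ?i \<otimes>\<^bsub>Q\<^esub> \<phi> x = \<phi> (y \<oplus> z)"
        using ab x J i by (simp add: dual_def Q.l_distr subset_iff)
      ultimately show ?thesis by blast
    qed
    then show ?thesis using ab by (simp add: dual_def)
  qed
  show "r \<otimes> a \<in> dual t J" if a: "a \<in> dual t J" and r: "r \<in> carrier R" for a r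
  proof -
    have "\<phi> (r \<otimes> a) \<otimes>\<^bsub>Q\<^esub> ?i \<otimes>\<^bsub>Q\<^esub> \<phi> x \<in> \<phi> ` carrier R" if x: "x \<in> J" for x
    proof -
      obtain y where "y \<in> carrier R" "\<phi> a \<otimes>\<^bsub>Q\<^esub> ?i \<otimes>\<^bsub>Q\<^esub> \<phi> x = \<phi> y"
        using a x unfolding dual_def by blast
      moreover from this have "\<phi> (r \<otimes> a) \<otimes>\<^bsub>Q\<^esub> ?i \<otimes>\<^bsub>Q\<^esub> \<phi> x = \<phi> (r \<otimes> y)"
        using a x J i r by (simp add: dual_def Q.m_assoc subset_iff)
      ultimately show ?thesis using r by blast
    qed
    then show ?thesis using a r by (simp add: dual_def)
  qed
qed

text \<open>
  \<open>J\<close> is reflexive. Every \<open>R\<close>-linear map \<open>g : J \<rightarrow> R\<close> is left multiplication by \<open>g(t) t\<inverse> \<in> J\<^sup>*\<close>, by the Ore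
  condition. A dual basis expands \<open>t = \<Sum> j g\<^sub>j(t)\<close>, and therefore \<open>x = \<Sum> j (g\<^sub>j(t) t\<inverse> x)\<close> for every \<open>x\<close>, where
  the coefficients lie in \<open>R\<close> as soon as \<open>J\<^sup>* x \<subseteq> R\<close>.
\<close>
lemma mem_if_dual:
  assumes J: "right_ideal J R" and t: "t \<in> regular_elements R" "t \<in> J" and x: "x \<in> carrier R"
    and dual: "\<And>a. a \<in> dual t J \<Longrightarrow> \<phi> a \<otimes>\<^bsub>Q\<^esub> inv\<^bsub>Q\<^esub> (\<phi> t) \<otimes>\<^bsub>Q\<^esub> \<phi> x \<in> \<phi> ` carrier R"
  shows "x \<in> J"
proof -
  let ?P = "(right_regular_module R)\<lparr>carrier := J\<rparr>" and ?i = "inv\<^bsub>Q\<^esub> (\<phi> t)"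
  have JR: "J \<subseteq> carrier R" using J by (simp add: right_ideal_iff)
  have tR: "t \<in> carrier R" and tU: "\<phi> t \<in> Units Q" using t regular_closed regular_unit by auto
  obtain g where g: "\<forall>j. g j \<in> rmod_hom R ?P (right_regular_module R)"
    "\<forall>y\<in>J. \<exists>K. finite K \<and> K \<subseteq> J \<and> y = (\<Oplus>j\<in>K. j \<otimes> g j y)"
    using dual_basis[OF J right_ideal_projective[OF J]] by blast
  have gR: "g j y \<in> carrier R" if "y \<in> J" for j y
    using g(1)[rule_format, of j] that by (auto simp: rmod_hom_def)
  have gmult: "g j (y \<otimes> r) = g j y \<otimes> r" if "y \<in> J" "r \<in> carrier R" for j y r
    using g(1) that by (intro rmod_hom_regular_mult[where f = "g j"]) blast+
  have shift: "\<phi> a \<otimes>\<^bsub>Q\<^esub> ?i \<otimes>\<^bsub>Q\<^esub> \<phi> y \<otimes>\<^bsub>Q\<^esub> \<phi> s = \<phi> (a \<otimes> b)"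
    if "a \<in> carrier R" "y \<in> carrier R" "s \<in> carrier R" "b \<in> carrier R" "y \<otimes> s = t \<otimes> b" for a y s b
  proof -
    have "\<phi> y \<otimes>\<^bsub>Q\<^esub> \<phi> s = \<phi> (t \<otimes> b)" using that(2,3) unfolding that(5)[symmetric] by simp
    then have "\<phi> a \<otimes>\<^bsub>Q\<^esub> ?i \<otimes>\<^bsub>Q\<^esub> \<phi> y \<otimes>\<^bsub>Q\<^esub> \<phi> s = \<phi> a \<otimes>\<^bsub>Q\<^esub> (?i \<otimes>\<^bsub>Q\<^esub> \<phi> (t \<otimes> b))"
      using that(1-4) tU by (simp add: Q.m_assoc)
    also have "\<dots> = \<phi> a \<otimes>\<^bsub>Q\<^esub> ((?i \<otimes>\<^bsub>Q\<^esub> \<phi> t) \<otimes>\<^bsub>Q\<^esub> \<phi> b)"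
      using that(4) tU tR by (simp add: Q.m_assoc del: Q.Units_l_inv)
    also have "\<dots> = \<phi> (a \<otimes> b)" using that tU by simp
    finally show ?thesis .
  qed
  have gt: "g j t \<in> dual t J" for j
  proof -
    have "\<phi> (g j t) \<otimes>\<^bsub>Q\<^esub> ?i \<otimes>\<^bsub>Q\<^esub> \<phi> y = \<phi> (g j y)" if y: "y \<in> J" for y
    proof -
      have yR: "y \<in> carrier R" using y JR by auto
      obtain b s where bs: "b \<in> carrier R" "s \<in> regular_elements R" "y \<otimes> s = t \<otimes> b"
        using ore_condition[OF yR t(1)] by blast
      have sR: "s \<in> carrier R" using bs regular_closed by auto
      have "\<phi> (g j t) \<otimes>\<^bsub>Q\<^esub> ?i \<otimes>\<^bsub>Q\<^esub> \<phi> y \<otimes>\<^bsub>Q\<^esub> \<phi> s = \<phi> (g j t \<otimes> b)"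
        using shift gR[OF t(2)] yR sR bs by simp
      also have "g j t \<otimes> b = g j y \<otimes> s"
        using gmult[OF t(2) bs(1)] gmult[OF y sR] bs(3) by simp
      finally have "\<phi> (g j t) \<otimes>\<^bsub>Q\<^esub> ?i \<otimes>\<^bsub>Q\<^esub> \<phi> y \<otimes>\<^bsub>Q\<^esub> \<phi> s = \<phi> (g j y) \<otimes>\<^bsub>Q\<^esub> \<phi> s"
        using gR[OF y] sR by simp
      then show ?thesis
        by (rule Q.Units_right_cancel[OF regular_unit[OF bs(2)], rotated 2]) (use gR t that yR tU in auto)
    qed
    then show ?thesis using gR t unfolding dual_def by auto
  qed
  obtain K where K: "finite K" "K \<subseteq> J" "t = (\<Oplus>j\<in>K. j \<otimes> g j t)" using g(2) t(2) by blast
  have "\<forall>j. \<exists>z. z \<in> carrier R \<and> \<phi> (g j t) \<otimes>\<^bsub>Q\<^esub> ?i \<otimes>\<^bsub>Q\<^esub> \<phi> x = \<phi> z" using dual[OF gt] by blast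
  then obtain z where z: "\<And>j. z j \<in> carrier R" "\<And>j. \<phi> (g j t) \<otimes>\<^bsub>Q\<^esub> ?i \<otimes>\<^bsub>Q\<^esub> \<phi> x = \<phi> (z j)" by metis
  obtain b s where bs: "b \<in> carrier R" "s \<in> regular_elements R" "x \<otimes> s = t \<otimes> b"
    using ore_condition[OF x t(1)] by blast
  have sR: "s \<in> carrier R" using bs regular_closed by auto
  have zs: "z j \<otimes> s = g j t \<otimes> b" for j
  proof -
    have "\<phi> (z j \<otimes> s) = \<phi> (g j t \<otimes> b)"
      using shift[of "g j t" x s b] z[of j] gR[OF t(2)] x sR bs by simp
    then show ?thesis using \<phi>_eq_iff[of "z j \<otimes> s" "g j t \<otimes> b"] z(1) gR[OF t(2)] sR bs by simp
  qed
  define x' where "x' = (\<Oplus>j\<in>K. j \<otimes> z j)"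
  have x': "x' \<in> J"
    unfolding x'_def using J K z by (intro right_ideal_finsum) (auto simp: right_ideal_iff)
  have "x' \<otimes> s = (\<Oplus>j\<in>K. j \<otimes> z j \<otimes> s)"
    unfolding x'_def using K JR z sR by (intro finsum_ldistr) auto
  also have "\<dots> = (\<Oplus>j\<in>K. j \<otimes> g j t \<otimes> b)"
  proof (intro finsum_cong')
    show "(\<lambda>j. j \<otimes> g j t \<otimes> b) \<in> K \<rightarrow> carrier R" using K JR gR[OF t(2)] bs by auto
    show "j \<otimes> z j \<otimes> s = j \<otimes> g j t \<otimes> b" if "j \<in> K" for j
    proof -
      have "j \<in> carrier R" using that K JR by auto
      then show ?thesis using zs[of j] z(1)[of j] gR[OF t(2), of j] sR bs by (simp add: m_assoc)
    qed
  qed simp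
  also have "\<dots> = (\<Oplus>j\<in>K. j \<otimes> g j t) \<otimes> b"
    using K JR gR[OF t(2)] bs by (intro finsum_ldistr[symmetric]) auto
  also have "\<dots> = x \<otimes> s" using K(3) bs(3) by simp
  finally have eq: "x' \<otimes> s = x \<otimes> s" .
  have x'R: "x' \<in> carrier R" using x' JR by auto
  have "x' = x"
    using Q.Units_right_cancel[OF regular_unit[OF bs(2)], of "\<phi> x'" "\<phi> x"] eq x'R x sR
    by (metis \<phi>.hom_mult \<phi>.hom_closed \<phi>_eq_iff)
  then show ?thesis using x' by simp
qed

text \<open>
  \<open>J \<mapsto> J\<^sup>*\<close> reverses inclusions and is injective, so the ascending chain condition on left ideals becomes the
  descending one on right ideals that contain \<open>t\<close>.
\<close>
lemma right_ideals_minimal: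
  assumes t: "t \<in> regular_elements R" and \<J>: "\<J> \<noteq> {}" "\<And>J. J \<in> \<J> \<Longrightarrow> right_ideal J R \<and> t \<in> J"
  shows "\<exists>J\<in>\<J>. \<forall>K\<in>\<J>. K \<subseteq> J \<longrightarrow> K = J"
proof -
  have "right_ideal (dual t J) (opposite_ring R)" if "J \<in> \<J>" for J
    using \<J>(2)[OF that] by (intro dual_left_ideal[OF t]) (simp add: right_ideal_iff)
  then have "\<exists>A\<in>dual t ` \<J>. \<forall>B\<in>dual t ` \<J>. A \<subseteq> B \<longrightarrow> B = A"
    using left_noetherian \<J>(1) by (intro right_noetherian_maximal) blast+
  then obtain J where J: "J \<in> \<J>" "\<And>K. K \<in> \<J> \<Longrightarrow> dual t J \<subseteq> dual t K \<Longrightarrow> dual t K = dual t J" by auto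
  have "K = J" if K: "K \<in> \<J>" "K \<subseteq> J" for K
  proof -
    have "dual t J \<subseteq> dual t K" using K(2) by (auto simp: dual_def)
    then have eq: "dual t K = dual t J" using J K by blast
    have "x \<in> K" if "x \<in> J" for x
    proof (rule mem_if_dual)
      show "\<phi> a \<otimes>\<^bsub>Q\<^esub> inv\<^bsub>Q\<^esub> (\<phi> t) \<otimes>\<^bsub>Q\<^esub> \<phi> x \<in> \<phi> ` carrier R" if "a \<in> dual t K" for a
        using that \<open>x \<in> J\<close> unfolding eq by (auto simp: dual_def)
      show "x \<in> carrier R" using that J(1) \<J>(2) unfolding right_ideal_iff by blast
    qed (use \<J>(2) K t in auto)
    then show ?thesis using K(2) by blast
  qed
  then show ?thesis using J(1) by blast
qed

text \<open>
  Noetherian induction: among the right ideals \<open>I\<close> that contain \<open>t\<close> and for which \<open>R/I\<close> has no finite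
  filtration, a maximal one has a minimal proper enlargement \<open>J'\<close>, which contributes one more simple
  factor to the filtration of \<open>R/J'\<close>.
\<close>
lemma finite_length_mod_regular:
  assumes t: "t \<in> regular_elements R" and J: "right_ideal J R" "t \<in> J"
  shows "\<exists>F. finite F \<and> (\<forall>N\<in>F. maximal_right_ideal N R) \<and>
    factor_chain R (right_regular_module R) (right_translates R F) J (carrier R)"
proof (rule ccontr)
  interpret M: right_module R "right_regular_module R" by (rule right_regular_right_module)
  define good where "good J \<longleftrightarrow> (\<exists>F. finite F \<and> (\<forall>N\<in>F. maximal_right_ideal N R) \<and>
    factor_chain R (right_regular_module R) (right_translates R F) J (carrier R))" for J
  define Bad where "Bad = {J. right_ideal J R \<and> t \<in> J \<and> \<not> good J}"
  assume "\<not> (\<exists>F. finite F \<and> (\<forall>N\<in>F. maximal_right_ideal N R) \<and>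
    factor_chain R (right_regular_module R) (right_translates R F) J (carrier R))"
  then have "Bad \<noteq> {}" using J unfolding Bad_def good_def by blast
  then have "\<exists>I\<in>Bad. \<forall>J\<in>Bad. I \<subseteq> J \<longrightarrow> J = I"
    using right_noetherian by (intro right_noetherian_maximal) (auto simp: Bad_def)
  then obtain I where I: "I \<in> Bad" "\<And>J. J \<in> Bad \<Longrightarrow> I \<subseteq> J \<Longrightarrow> J = I" by blast
  have Ir: "right_ideal I R" "t \<in> I" "\<not> good I" using I(1) by (auto simp: Bad_def)
  have "good (carrier R)" unfolding good_def by (intro exI[of _ "{}"]) simp
  then have "I \<subset> carrier R" using Ir by (auto simp: right_ideal_iff)
  then have "\<exists>J\<in>{J. right_ideal J R \<and> I \<subset> J}. \<forall>K\<in>{J. right_ideal J R \<and> I \<subset> J}. K \<subseteq> J \<longrightarrow> K = J"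
    using right_ideal_carrier Ir by (intro right_ideals_minimal[OF t]) auto
  then obtain J' where J': "right_ideal J' R" "I \<subset> J'"
    "\<And>K. right_ideal K R \<Longrightarrow> I \<subset> K \<Longrightarrow> K \<subseteq> J' \<Longrightarrow> K = J'" by auto
  have "good J'" using I(2)[of J'] J' Ir by (auto simp: Bad_def)
  then obtain F where F: "finite F" "\<forall>N\<in>F. maximal_right_ideal N R"
    "factor_chain R (right_regular_module R) (right_translates R F) J' (carrier R)"
    unfolding good_def by blast
  obtain N where N: "maximal_right_ideal N R"
    "factor_step R (right_regular_module R) (right_translates R {N}) I J'"
    using M.minimal_overmodule_factor_step[of I J'] Ir J' unfolding right_ideal_iff_submodule by blast
  have "factor_chain R (right_regular_module R) (right_translates R (insert N F)) I J'"
    using factor_chain_mono[OF r_into_rtranclp[of "factor_step R (right_regular_module R) (right_translates R {N})", OF N(2)]]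
      right_translates_mono[of "{N}" "insert N F"] by blast
  moreover have "factor_chain R (right_regular_module R) (right_translates R (insert N F)) J' (carrier R)"
    using factor_chain_mono[OF F(3)] right_translates_mono[of F "insert N F"] by blast
  ultimately have "good I"
    unfolding good_def using F N by (intro exI[of _ "insert N F"]) auto
  with Ir show False by simp
qed

end

section \<open>The torsion subring of the quotient ring\<close>

context hnp_quotient
begin

abbreviation V where "V \<equiv> fraction_module Q \<phi>"

lemma fraction_module: "right_module R V"
proof -
  have "abelian_group V"
    by (rule abelian_groupI) (auto simp: Q.a_assoc Q.a_comm Q.a_lcomm intro: Q.l_neg)
  then show ?thesis
    by (auto simp: right_module_def right_module_axioms_def ring_axioms Q.l_distr Q.r_distr Q.m_assoc)
qed

sublocale V: right_module R V by (rule fraction_module)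

lemma embedding_hom: "\<phi> \<in> rmod_hom R (right_regular_module R) V"
  by (auto simp: rmod_hom_def)

lemma left_mult_hom: "p \<in> carrier Q \<Longrightarrow> (\<otimes>\<^bsub>Q\<^esub>) p \<in> rmod_hom R V V"
  by (auto simp: rmod_hom_def Q.r_distr Q.m_assoc)

lemma embedding_submodule: "right_ideal J R \<Longrightarrow> submodule (\<phi> ` J) R V"
  using rmod_hom_image_submodule[OF right_regular_right_module fraction_module embedding_hom]
  by (simp add: right_ideal_iff_submodule)

definition torsion :: "'a set set \<Rightarrow> 'b set"
  where "torsion \<M> = {q. \<exists>B. factor_chain R V \<M> (\<phi> ` carrier R) B \<and> q \<in> B}"

lemma torsion_mono: "\<M> \<subseteq> \<N> \<Longrightarrow> torsion \<M> \<subseteq> torsion \<N>"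
  unfolding torsion_def using factor_chain_mono[of R V \<M>] by blast

text \<open>
  Write \<open>q = t\<inverse> b\<close>. Left multiplication by \<open>t\<inverse>\<close> turns a filtration between \<open>t R\<close> and \<open>R\<close> into one between \<open>R\<close> and
  \<open>t\<inverse> R\<close>, which contains \<open>q\<close>.
\<close>
lemma fraction_in_torsion:
  assumes q: "q \<in> carrier Q"
  shows "\<exists>F. finite F \<and> (\<forall>N\<in>F. maximal_right_ideal N R) \<and> q \<in> torsion (right_translates R F)"
proof -
  obtain b t where bt: "b \<in> carrier R" "t \<in> regular_elements R" "q = inv\<^bsub>Q\<^esub> (\<phi> t) \<otimes>\<^bsub>Q\<^esub> \<phi> b"
    using left_fraction[OF q] by blast
  let ?i = "inv\<^bsub>Q\<^esub> (\<phi> t)"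
  have t: "t \<in> carrier R" "\<phi> t \<in> Units Q" using bt regular_closed regular_unit by auto
  have tJ: "right_ideal ((\<otimes>) t ` carrier R) R" "t \<in> (\<otimes>) t ` carrier R"
    using right_ideal_image_mult[OF right_ideal_carrier t(1)] image_eqI[of t "(\<otimes>) t" \<one>] t by simp_all
  obtain F where F: "finite F" "\<forall>N\<in>F. maximal_right_ideal N R"
    "factor_chain R (right_regular_module R) (right_translates R F) ((\<otimes>) t ` carrier R) (carrier R)"
    using finite_length_mod_regular[OF bt(2) tJ] by blast
  note max = right_translates_maximal[OF F(2)]
  have "factor_chain R V (right_translates R F) (\<phi> ` (\<otimes>) t ` carrier R) (\<phi> ` carrier R)"
    by (rule factor_chain_image[OF right_regular_right_module fraction_module embedding_hom F(3) max])
  then have "factor_chain R V (right_translates R F)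
      ((\<otimes>\<^bsub>Q\<^esub>) ?i ` \<phi> ` (\<otimes>) t ` carrier R) ((\<otimes>\<^bsub>Q\<^esub>) ?i ` \<phi> ` carrier R)"
    using factor_chain_image[OF fraction_module fraction_module left_mult_hom _ max] t by simp
  moreover have "(\<otimes>\<^bsub>Q\<^esub>) ?i ` \<phi> ` (\<otimes>) t ` carrier R = \<phi> ` carrier R"
  proof -
    have "?i \<otimes>\<^bsub>Q\<^esub> \<phi> (t \<otimes> r) = \<phi> r" if "r \<in> carrier R" for r
      using that t by (simp flip: Q.m_assoc)
    then show ?thesis unfolding image_image by (rule image_cong[OF refl])
  qed
  moreover have "q \<in> (\<otimes>\<^bsub>Q\<^esub>) ?i ` \<phi> ` carrier R" using bt by blast
  ultimately show ?thesis using F unfolding torsion_def by auto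
qed

text \<open>
  If \<open>B\<close> and \<open>C\<close> are torsion extensions of \<open>R\<close> with \<open>p \<in> B\<close> and \<open>q \<in> C\<close>, then \<open>B + C\<close> is one that contains \<open>p + q\<close>, and
  \<open>B + p C\<close> is one that contains \<open>p q\<close>, as \<open>p C\<close> is a torsion extension of \<open>p R \<subseteq> B\<close>.
\<close>
lemma torsion_subring:
  assumes max: "\<forall>I\<in>\<M>. maximal_right_ideal I R"
  shows "subring (torsion \<M>) Q"
proof -
  let ?R = "\<phi> ` carrier R"
  have R: "submodule ?R R V" by (rule embedding_submodule[OF right_ideal_carrier])
  have sub: "submodule B R V" "?R \<subseteq> B" if "factor_chain R V \<M> ?R B" for B
    using factor_chain_submodule[OF that R] factor_chain_subset[OF that] by auto
  \<comment> \<open>A chain that starts inside \<open>C\<close> prolongs a chain that ends in \<open>C\<close>.\<close>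
  have extend: "factor_chain R V \<M> ?R (C <+>\<^bsub>V\<^esub> B)"
    if C: "factor_chain R V \<M> ?R C" and A: "factor_chain R V \<M> A B" "A \<subseteq> C" "submodule A R V" for A B C
    using C V.factor_chain_add[OF A(1) sub(1)[OF C] max] V.submodule_sum_absorb[OF A(3) sub(1)[OF C] A(2)]
    by simp
  have mem_sum: "b \<in> C <+>\<^bsub>V\<^esub> B" if "submodule C R V" "submodule B R V" "b \<in> B" for b B C
  proof -
    have "b = \<zero>\<^bsub>V\<^esub> \<oplus>\<^bsub>V\<^esub> b" "\<zero>\<^bsub>V\<^esub> \<in> C" using that unfolding V.submodule_iff by auto
    then show ?thesis using that unfolding set_add_def' by blast
  qed
  show ?thesis
  proof (rule Q.subringI)
    show "torsion \<M> \<subseteq> carrier Q" using sub(1) unfolding torsion_def V.submodule_iff fraction_module_simps by blast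
    have "\<one>\<^bsub>Q\<^esub> \<in> ?R" using image_eqI[of "\<one>\<^bsub>Q\<^esub>" \<phi> \<one>] by simp
    then show "\<one>\<^bsub>Q\<^esub> \<in> torsion \<M>" unfolding torsion_def by blast
    show "\<ominus>\<^bsub>Q\<^esub> p \<in> torsion \<M>" if p: "p \<in> torsion \<M>" for p
    proof -
      obtain B where B: "factor_chain R V \<M> ?R B" "p \<in> B" using p by (auto simp: torsion_def)
      have "p \<in> carrier Q" using sub(1)[OF B(1)] B(2) unfolding V.submodule_iff by auto
      then have "(\<ominus> \<one>) \<odot>\<^bsub>V\<^esub> p = \<ominus>\<^bsub>Q\<^esub> p" by (simp add: Q.r_minus)
      moreover have "(\<ominus> \<one>) \<odot>\<^bsub>V\<^esub> p \<in> B"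
        using sub(1)[OF B(1)] B(2) unfolding V.submodule_iff by (meson add.inv_closed one_closed)
      ultimately show ?thesis using B(1) unfolding torsion_def by auto
    qed
    show "p \<otimes>\<^bsub>Q\<^esub> q \<in> torsion \<M>" if pq: "p \<in> torsion \<M>" "q \<in> torsion \<M>" for p q
    proof -
      obtain B C where BC: "factor_chain R V \<M> ?R B" "p \<in> B" "factor_chain R V \<M> ?R C" "q \<in> C"
        using pq by (auto simp: torsion_def)
      have p: "p \<in> carrier Q" using sub(1)[OF BC(1)] BC(2) unfolding V.submodule_iff by auto
      note hom = left_mult_hom[OF p]
      have "factor_chain R V \<M> ((\<otimes>\<^bsub>Q\<^esub>) p ` ?R) ((\<otimes>\<^bsub>Q\<^esub>) p ` C)"
        by (rule factor_chain_image[OF fraction_module fraction_module hom BC(3) max])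
      moreover have "(\<otimes>\<^bsub>Q\<^esub>) p ` ?R \<subseteq> B"
        using sub(1)[OF BC(1)] BC(2) unfolding V.submodule_iff by auto
      ultimately have "factor_chain R V \<M> ?R (B <+>\<^bsub>V\<^esub> ((\<otimes>\<^bsub>Q\<^esub>) p ` C))"
        using rmod_hom_image_submodule[OF fraction_module fraction_module hom R] by (intro extend[OF BC(1)])
      moreover have "p \<otimes>\<^bsub>Q\<^esub> q \<in> B <+>\<^bsub>V\<^esub> ((\<otimes>\<^bsub>Q\<^esub>) p ` C)"
        using sub(1)[OF BC(1)] BC(4)
          rmod_hom_image_submodule[OF fraction_module fraction_module hom sub(1)[OF BC(3)]]
        by (intro mem_sum) auto
      ultimately show ?thesis unfolding torsion_def by blast
    qed
    show "p \<oplus>\<^bsub>Q\<^esub> q \<in> torsion \<M>" if pq: "p \<in> torsion \<M>" "q \<in> torsion \<M>" for p q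
    proof -
      obtain B C where BC: "factor_chain R V \<M> ?R B" "p \<in> B" "factor_chain R V \<M> ?R C" "q \<in> C"
        using pq by (auto simp: torsion_def)
      have "factor_chain R V \<M> ?R (B <+>\<^bsub>V\<^esub> C)"
        by (rule extend[OF BC(1,3) sub(2)[OF BC(1)] R])
      moreover have "p \<oplus>\<^bsub>Q\<^esub> q \<in> B <+>\<^bsub>V\<^esub> C" using BC unfolding set_add_def' by auto
      ultimately show ?thesis unfolding torsion_def by blast
    qed
  qed
qed

text \<open>
  Multiplying a torsion extension of \<open>R\<close> that contains \<open>s\<inverse>\<close> by \<open>s\<close> gives one of \<open>s R\<close> that contains \<open>1\<close>. Adding \<open>M \<supseteq> s R\<close>
  and cutting down to \<open>R\<close> makes \<open>R/M\<close> torsion, and the first proper step of this filtration starts at \<open>M\<close>.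
\<close>
lemma residual_mem_if_torsion_eq_carrier:
  assumes max: "\<forall>I\<in>\<M>. maximal_right_ideal I R"
    and all: "torsion \<M> = carrier Q"
    and M: "right_ideal M R" "\<one> \<notin> M" and s: "s \<in> M" "s \<in> regular_elements R"
  shows "\<exists>b\<in>carrier R - M. residual R (right_regular_module R) M b \<in> \<M>"
proof -
  let ?R = "\<phi> ` carrier R"
  have sR: "s \<in> carrier R" "\<phi> s \<in> Units Q" using s regular_closed regular_unit by auto
  have MR: "M \<subseteq> carrier R" using M by (simp add: right_ideal_iff)
  have "inv\<^bsub>Q\<^esub> (\<phi> s) \<in> torsion \<M>" using all sR by simp
  then obtain B where B: "factor_chain R V \<M> ?R B" "inv\<^bsub>Q\<^esub> (\<phi> s) \<in> B" by (auto simp: torsion_def)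
  have subR: "submodule ?R R V" by (rule embedding_submodule[OF right_ideal_carrier])
  have subB: "submodule B R V" by (rule factor_chain_submodule[OF B(1) subR])
  have subM: "submodule (\<phi> ` M) R V" by (rule embedding_submodule[OF M(1)])
  note hom = left_mult_hom[OF \<phi>.hom_closed[OF sR(1)]]
  let ?A = "(\<otimes>\<^bsub>Q\<^esub>) (\<phi> s) ` ?R" and ?B = "(\<otimes>\<^bsub>Q\<^esub>) (\<phi> s) ` B"
  have subA: "submodule ?A R V" and subB': "submodule ?B R V"
    using rmod_hom_image_submodule[OF fraction_module fraction_module hom] subR subB by auto
  have chain: "factor_chain R V \<M> (\<phi> ` M <+>\<^bsub>V\<^esub> ?A) (\<phi> ` M <+>\<^bsub>V\<^esub> ?B)"
    using factor_chain_image[OF fraction_module fraction_module hom B(1) max] subM max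
    by (intro V.factor_chain_add) auto
  have "?A \<subseteq> \<phi> ` M"
  proof
    fix y assume "y \<in> ?A"
    then obtain r where "r \<in> carrier R" "y = \<phi> (s \<otimes> r)" using sR by auto
    then show "y \<in> \<phi> ` M" using M(1) s(1) by (auto simp: right_ideal_iff)
  qed
  then have "\<phi> ` M <+>\<^bsub>V\<^esub> ?A = \<phi> ` M" by (intro V.submodule_sum_absorb subA subM)
  with chain have chain': "factor_chain R V \<M> (\<phi> ` M) (\<phi> ` M <+>\<^bsub>V\<^esub> ?B)" by simp
  have one: "\<one>\<^bsub>Q\<^esub> \<in> \<phi> ` M <+>\<^bsub>V\<^esub> ?B"
  proof -
    have "\<one>\<^bsub>Q\<^esub> = \<zero>\<^bsub>V\<^esub> \<oplus>\<^bsub>V\<^esub> (\<phi> s \<otimes>\<^bsub>Q\<^esub> inv\<^bsub>Q\<^esub> (\<phi> s))" using sR by simp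
    moreover have "\<zero>\<^bsub>V\<^esub> \<in> \<phi> ` M" using subM unfolding V.submodule_iff by blast
    ultimately show ?thesis using B(2) unfolding set_add_def' by blast
  qed
  \<comment> \<open>Cut the chain down to \<open>R\<close>: it still leads from \<open>M\<close> to a module containing \<open>1\<close>.\<close>
  have "\<phi> ` M \<inter> ?R = \<phi> ` M" using MR by auto
  then have cut: "factor_chain R V \<M> (\<phi> ` M) ((\<phi> ` M <+>\<^bsub>V\<^esub> ?B) \<inter> ?R)"
    using V.factor_chain_Int[OF chain' subR] by simp
  have "\<one>\<^bsub>Q\<^esub> \<in> ?R" using image_eqI[of "\<one>\<^bsub>Q\<^esub>" \<phi> \<one>] by simp
  moreover have "\<one>\<^bsub>Q\<^esub> \<notin> \<phi> ` M"
    using M(2) MR \<phi>_eq_iff[OF one_closed] by auto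
  ultimately have "\<phi> ` M \<noteq> (\<phi> ` M <+>\<^bsub>V\<^esub> ?B) \<inter> ?R" using one by blast
  then obtain y where y: "y \<in> ?R" "y \<notin> \<phi> ` M" "residual R V (\<phi> ` M) y \<in> \<M>"
    using factor_chain_first[OF cut] by blast
  then obtain b where b: "b \<in> carrier R" "y = \<phi> b" by blast
  have "\<phi> b \<otimes>\<^bsub>Q\<^esub> \<phi> r \<in> \<phi> ` M \<longleftrightarrow> b \<otimes> r \<in> M" if r: "r \<in> carrier R" for r
  proof
    assume "\<phi> b \<otimes>\<^bsub>Q\<^esub> \<phi> r \<in> \<phi> ` M"
    then obtain m where "m \<in> M" "\<phi> (b \<otimes> r) = \<phi> m" using b r by auto
    then show "b \<otimes> r \<in> M" using \<phi>_eq_iff[of "b \<otimes> r" m] b r MR by auto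
  next
    assume "b \<otimes> r \<in> M"
    then show "\<phi> b \<otimes>\<^bsub>Q\<^esub> \<phi> r \<in> \<phi> ` M" using b r by (metis \<phi>.hom_mult imageI)
  qed
  then have "residual R V (\<phi> ` M) y = residual R (right_regular_module R) M b"
    using b by (auto simp: residual_def)
  then show ?thesis using y b by auto
qed

text \<open>
  \<open>H\<close> collects the factors that occur for the finitely many generators. A simple module is labelled by
  some \<open>N \<in> H\<close> with \<open>S \<cong> R/N\<close>, or by \<open>None\<close> if one of its nonzero elements has an annihilator that is not
  essential.
\<close>
lemma finitely_many_simple_modules_if_finitely_generated:
  assumes F: "finite F" "F \<subseteq> carrier Q" and gen: "generate_ring Q (\<phi> ` carrier R \<union> F) = carrier Q"
  shows "finite (simple_right_module_classes R)"
proof -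
  have "\<forall>q\<in>F. \<exists>G. finite G \<and> (\<forall>N\<in>G. maximal_right_ideal N R) \<and> q \<in> torsion (right_translates R G)"
    using fraction_in_torsion F(2) by blast
  then obtain G where G: "\<And>q. q \<in> F \<Longrightarrow> finite (G q)"
    "\<And>q. q \<in> F \<Longrightarrow> \<forall>N\<in>G q. maximal_right_ideal N R"
    "\<And>q. q \<in> F \<Longrightarrow> q \<in> torsion (right_translates R (G q))" by metis
  define H where "H = (\<Union>q\<in>F. G q)"
  have H: "finite H" "\<forall>N\<in>H. maximal_right_ideal N R" using F G by (auto simp: H_def)
  let ?\<M> = "right_translates R H"
  have max: "\<forall>I\<in>?\<M>. maximal_right_ideal I R" by (rule right_translates_maximal[OF H(2)])
  have "F \<subseteq> torsion ?\<M>"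
  proof
    fix q assume q: "q \<in> F"
    have "right_translates R (G q) \<subseteq> ?\<M>" by (rule right_translates_mono) (use q in \<open>auto simp: H_def\<close>)
    then show "q \<in> torsion ?\<M>" using torsion_mono G(3)[OF q] by blast
  qed
  moreover have "\<phi> ` carrier R \<subseteq> torsion ?\<M>" unfolding torsion_def by blast
  ultimately have "generate_ring Q (\<phi> ` carrier R \<union> F) \<subseteq> torsion ?\<M>"
    using F(2) torsion_subring[OF max] by (intro Q.generate_ring_min_subring1) auto
  then have all: "torsion ?\<M> = carrier Q"
    using gen Q.carrier_is_subring subringE(1)[OF torsion_subring[OF max]] by auto
  let ?ann = "\<lambda>S :: ('a, 'a set) module. residual R S {\<zero>\<^bsub>S\<^esub>}"
  have cases: "(\<exists>x\<in>carrier S. x \<noteq> \<zero>\<^bsub>S\<^esub> \<and> \<not> essential_right_ideal (?ann S x) R) \<or>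
      (\<exists>N\<in>H. \<exists>x\<in>carrier S. ?ann S x \<in> right_translates R {N})"
    if S: "simple_right_module R S" for S :: "('a, 'a set) module"
  proof -
    interpret S: right_module R S using S by (simp add: simple_right_module_def)
    have "carrier S \<noteq> {\<zero>\<^bsub>S\<^esub>}" using S by (simp add: simple_right_module_def)
    then obtain x where x: "x \<in> carrier S" "x \<noteq> \<zero>\<^bsub>S\<^esub>" using S.M.zero_closed by blast
    have M: "maximal_right_ideal (?ann S x) R" by (rule simple_module_generator(2)[OF S x])
    show ?thesis
    proof (cases "essential_right_ideal (?ann S x) R")
      case True
      then obtain s where s: "s \<in> ?ann S x" "s \<in> regular_elements R"
        using essential_contains_regular by blast
      obtain b where b: "b \<in> carrier R" "residual R (right_regular_module R) (?ann S x) b \<in> ?\<M>"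
        using residual_mem_if_torsion_eq_carrier[OF max all _ _ s] M
        unfolding maximal_right_ideal_def by blast
      have "?ann S (b \<odot>\<^bsub>S\<^esub> x) \<in> ?\<M>" using b S.residual_ract[OF x(1) b(1)] by simp
      then have "\<exists>N\<in>H. ?ann S (b \<odot>\<^bsub>S\<^esub> x) \<in> right_translates R {N}"
        unfolding right_translates_def by blast
      then show ?thesis using S.ract_closed[OF b(1) x(1)] by blast
    qed (use x in blast)
  qed
  define k where "k S = (if \<exists>x\<in>carrier S. x \<noteq> \<zero>\<^bsub>S\<^esub> \<and> \<not> essential_right_ideal (?ann S x) R then None
      else Some (SOME N. N \<in> H \<and> (\<exists>x\<in>carrier S. ?ann S x \<in> right_translates R {N})))" for S
  have k_Some: "N \<in> H \<and> (\<exists>x\<in>carrier S. ?ann S x \<in> right_translates R {N})"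
    if S: "simple_right_module R S" "k S = Some N" for S N
  proof -
    have "\<exists>N. N \<in> H \<and> (\<exists>x\<in>carrier S. ?ann S x \<in> right_translates R {N})"
      using cases[OF S(1)] S(2) by (auto simp: k_def split: if_splits)
    from someI_ex[OF this] show ?thesis using S(2) by (simp add: k_def split: if_splits)
  qed
  show ?thesis
  proof (rule finite_simple_right_module_classes[where k = k])
    show "finite (insert None (Some ` H))" using H by simp
    show "k S \<in> insert None (Some ` H)" if "simple_right_module R S" for S
      using k_Some[OF that] by (cases "k S") auto
    show "rmod_iso R S T" if S: "simple_right_module R S" and T: "simple_right_module R T"
      and eq: "k S = k T" for S T
    proof (cases "k S")
      case None
      then have "k T = None" using eq by simp
      obtain x where x: "x \<in> carrier S" "x \<noteq> \<zero>\<^bsub>S\<^esub>" "\<not> essential_right_ideal (?ann S x) R"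
        using None unfolding k_def by (metis option.distinct(1))
      obtain y where y: "y \<in> carrier T" "y \<noteq> \<zero>\<^bsub>T\<^esub>" "\<not> essential_right_ideal (?ann T y) R"
        using \<open>k T = None\<close> unfolding k_def by (metis option.distinct(1))
      show ?thesis by (rule simple_modules_iso_of_not_essential[OF prime S x T y])
    next
      case (Some N)
      obtain x where x: "N \<in> H" "x \<in> carrier S" "?ann S x \<in> right_translates R {N}"
        using k_Some[OF S Some] by blast
      obtain y where y: "y \<in> carrier T" "?ann T y \<in> right_translates R {N}"
        using k_Some[OF T] Some eq by force
      have N: "maximal_right_ideal N R" using H(2) x(1) by blast
      show ?thesis by (rule simple_modules_iso_translate[OF N S x(2,3) T y])
    qed
  qed
qed

end

section \<open>The quotient ring as an algebra over the center\<close>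

lemma (in ring) center_subcring: "subcring (ring_center R) R"
proof (rule subcringI)
  show "subring (ring_center R) R"
  proof (rule subringI)
    show "h1 \<otimes> h2 \<in> ring_center R" if "h1 \<in> ring_center R" "h2 \<in> ring_center R" for h1 h2
    proof -
      have h: "h1 \<in> carrier R" "h2 \<in> carrier R" "\<And>x. x \<in> carrier R \<Longrightarrow> h1 \<otimes> x = x \<otimes> h1"
        "\<And>x. x \<in> carrier R \<Longrightarrow> h2 \<otimes> x = x \<otimes> h2"
        using that by (simp_all add: ring_center_def)
      have "h1 \<otimes> h2 \<otimes> x = x \<otimes> (h1 \<otimes> h2)" if x: "x \<in> carrier R" for x
      proof -
        have "h1 \<otimes> h2 \<otimes> x = h1 \<otimes> (x \<otimes> h2)" using h(1,2) h(4)[OF x] x by (simp add: m_assoc)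
        also have "\<dots> = x \<otimes> h1 \<otimes> h2" using h(1,2) h(3)[OF x] x by (simp flip: m_assoc)
        finally show ?thesis using h(1,2) x by (simp add: m_assoc)
      qed
      then show ?thesis using h(1,2) by (simp add: ring_center_def)
    qed
    show "\<ominus> h \<in> ring_center R" if "h \<in> ring_center R" for h
      using that unfolding ring_center_def by (simp add: l_minus r_minus)
    show "h1 \<oplus> h2 \<in> ring_center R" if "h1 \<in> ring_center R" "h2 \<in> ring_center R" for h1 h2
      using that unfolding ring_center_def by (simp add: l_distr r_distr)
  qed (simp_all add: ring_center_def)
  show "h1 \<otimes> h2 = h2 \<otimes> h1" if "h1 \<in> ring_center R" "h2 \<in> ring_center R" for h1 h2
    using that unfolding ring_center_def by blast
qed

context hnp_quotient
begin

text \<open>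
  A central \<open>z\<close> of \<open>R\<close> commutes with \<open>a = q s\<close> and with the unit \<open>s\<close>, hence with \<open>q = a s\<inverse>\<close>.
\<close>
lemma center_embeds: "\<phi> ` ring_center R \<subseteq> ring_center Q"
proof
  fix y assume "y \<in> \<phi> ` ring_center R"
  then obtain z where z: "z \<in> carrier R" "\<And>x. x \<in> carrier R \<Longrightarrow> z \<otimes> x = x \<otimes> z" "y = \<phi> z"
    by (auto simp: ring_center_def)
  have comm: "\<phi> z \<otimes>\<^bsub>Q\<^esub> \<phi> x = \<phi> x \<otimes>\<^bsub>Q\<^esub> \<phi> z" if "x \<in> carrier R" for x
    using z that by (metis \<phi>.hom_mult)
  have "\<phi> z \<otimes>\<^bsub>Q\<^esub> q = q \<otimes>\<^bsub>Q\<^esub> \<phi> z" if q: "q \<in> carrier Q" for q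
  proof -
    obtain a s where as: "a \<in> carrier R" "s \<in> regular_elements R" "q \<otimes>\<^bsub>Q\<^esub> \<phi> s = \<phi> a"
      using right_fraction[OF q] by blast
    have s: "s \<in> carrier R" "\<phi> s \<in> Units Q" using as regular_closed regular_unit by auto
    have "\<phi> z \<otimes>\<^bsub>Q\<^esub> q \<otimes>\<^bsub>Q\<^esub> \<phi> s = \<phi> z \<otimes>\<^bsub>Q\<^esub> \<phi> a"
      using z q s as by (simp add: Q.m_assoc)
    also have "\<dots> = q \<otimes>\<^bsub>Q\<^esub> \<phi> s \<otimes>\<^bsub>Q\<^esub> \<phi> z" using comm as by simp
    also have "\<dots> = q \<otimes>\<^bsub>Q\<^esub> (\<phi> z \<otimes>\<^bsub>Q\<^esub> \<phi> s)" using comm s q z by (simp add: Q.m_assoc)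
    also have "\<dots> = q \<otimes>\<^bsub>Q\<^esub> \<phi> z \<otimes>\<^bsub>Q\<^esub> \<phi> s" using s q z by (simp add: Q.m_assoc)
    finally show ?thesis by (rule Q.Units_right_cancel[OF s(2), rotated 2]) (use z q in auto)
  qed
  then show "y \<in> ring_center Q" using z by (simp add: ring_center_def)
qed

lemma center_algebra: "assoc_algebra (R\<lparr>carrier := ring_center R\<rparr>) Q \<phi>"
proof -
  have Z: "ring_center R \<subseteq> carrier R" by (auto simp: ring_center_def)
  have "cring (R\<lparr>carrier := ring_center R\<rparr>)" using center_subcring subcring_iff[OF Z] by simp
  moreover have "\<phi> \<in> ring_hom (R\<lparr>carrier := ring_center R\<rparr>) Q"
    using Z by (auto simp: ring_hom_def subset_iff)
  ultimately show ?thesis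
    using center_embeds Q.ring_axioms by (simp add: assoc_algebra_def)
qed

end

theorem theorem2p2:
  fixes R :: "('a, 'r) ring_scheme" and Q :: "('b, 'q) ring_scheme" and \<phi> :: "'a \<Rightarrow> 'b"
  assumes "hnp_ring R"
    and "infinite (simple_right_module_classes R)"
    and "goldie_quotient_ring R Q \<phi>"
  shows "(\<forall>F. finite F \<and> F \<subseteq> carrier Q \<longrightarrow>
            generate_ring Q (\<phi> ` carrier R \<union> F) \<noteq> carrier Q)
    \<and> assoc_algebra (R\<lparr>carrier := ring_center R\<rparr>) Q \<phi>
    \<and> \<not> affine_algebra (R\<lparr>carrier := ring_center R\<rparr>) Q \<phi>"
proof -
  interpret hnp_quotient R Q \<phi>
    using assms(1,3)
    by (intro hnp_quotient.intro hnp.intro hnp_axioms.intro hnp_quotient_axioms.intro)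
      (simp_all add: hnp_ring_def)
  have not_generated: "generate_ring Q (\<phi> ` carrier R \<union> F) \<noteq> carrier Q"
    if "finite F" "F \<subseteq> carrier Q" for F
    using finitely_many_simple_modules_if_finitely_generated[OF that] assms(2) by blast
  have "\<not> affine_algebra (R\<lparr>carrier := ring_center R\<rparr>) Q \<phi>"
  proof
    assume "affine_algebra (R\<lparr>carrier := ring_center R\<rparr>) Q \<phi>"
    then obtain F where F: "finite F" "F \<subseteq> carrier Q"
      "generate_ring Q (\<phi> ` ring_center R \<union> F) = carrier Q"
      by (auto simp: affine_algebra_def)
    have sub: "\<phi> ` carrier R \<union> F \<subseteq> carrier Q" using F by auto
    have "generate_ring Q (\<phi> ` ring_center R \<union> F) \<subseteq> generate_ring Q (\<phi> ` carrier R \<union> F)"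
      by (rule Q.mono_generate_ring[OF _ sub]) (auto simp: ring_center_def)
    then have "generate_ring Q (\<phi> ` carrier R \<union> F) = carrier Q"
      using F(3) Q.generate_ring_incl[OF sub] by blast
    then show False using not_generated F by blast
  qed
  then show ?thesis using not_generated center_algebra by blast
qed

end
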